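(* Let $G$ be a cop-win graph on $n\ge 11$ vertices. Then $G$ has capture time $n-5$ if and only if one of the following holds: (1) $G$ 1-realizes a standard extension of $(1,4,2,1)$; (2) $G$ 1-realizes a vector obtained from a standard extension of $(2,2,2,1)$ by adding 1 to exactly one entry; (3) $G$ 0-realizes a standard extension of $(3,3,2,1)$.
   Context: All graphs are finite, nonempty, and reflexive (every vertex has a loop, so each vertex is adjacent to itself). $N[v]$ denotes the closed neighborhood of $v$ (including $v$). For distinct vertices $v,w$, $w$ strictly corners $v$ if $N[v]\subsetneq N[w]$; $v$ is then a strict corner. A vertex dominates a set if it is adjacent to every vertex of it. Cops and robbers: a cop chooses a vertex, then the robber; then they alternate moves, cop first, each move to an adjacent vertex or staying. The cop wins upon occupying the robber's vertex. $G$ is cop-win if the cop can force a win; the capture time of a cop-win graph is the minimum number of cop moves (not counting her initial placement) needed to guarantee capture. Corner ranking: set $G^{(1)}=G$, $k=1$. If $G^{(k)}$ is a clique, give all its vertices rank $k$ and stop. Else if $G^{(k)}$ has no strict corners, give all its vertices rank $\infty$ and stop. Else give every strict corner of $G^{(k)}$ rank $k$, delete them to obtain $G^{(k+1)}$ (induced subgraph), increase $k$ and repeat. The corner rank of $G$ is the largest rank of a vertex; $X_k$ is the set of rank-$k$ vertices. If $G$ has finite corner rank $\alpha\ge 2$, $G$ is of type 1 if some (equivalently every) vertex of rank $\alpha$ dominates $V(G^{(\alpha-1)})$, and of type 0 otherwise. (Known: $G$ is cop-win iff its corner rank is finite, and then a type-$r$ graph has capture time $\alpha-r$.) A vector is a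 finite list of positive integers. The rank cardinality vector of $G$ of corner rank $\alpha$ is $(x_\alpha,\dots,x_1)$ with $x_k=|X_k|$. $G$ $r$-realizes a vector ($r\in\{0,1\}$) if $G$ is cop-win of type $r$ and the vector is its rank cardinality vector. A standard extension of $(x_\alpha,\dots,x_1)$ is any vector $(x_\alpha,\dots,x_1,x_1,\dots,x_1)$ obtained by appending zero or more copies of the last entry $x_1$. *)

theory Defs
  imports Main
begin

definition rgraph :: "'a set \<Rightarrow> ('a \<Rightarrow> 'a \<Rightarrow> bool) \<Rightarrow> bool" where
  "rgraph V E \<longleftrightarrow> finite V \<and> V \<noteq> {} \<and> (\<forall>v\<in>V. E v v)
     \<and> (\<forall>u v. E u v \<longrightarrow> E v u) \<and> (\<forall>u v. E u v \<longrightarrow> u \<in> V \<and> v \<in> V)"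

text \<open>cop_wins_within V E k c r: cop at c, robber at r, cop to move;
  the cop can force capture using at most k further cop moves.\<close>
fun cop_wins_within :: "'a set \<Rightarrow> ('a \<Rightarrow> 'a \<Rightarrow> bool) \<Rightarrow> nat \<Rightarrow> 'a \<Rightarrow> 'a \<Rightarrow> bool" where
  "cop_wins_within V E 0 c r \<longleftrightarrow> c = r"
| "cop_wins_within V E (Suc k) c r \<longleftrightarrow> c = r \<or>
     (\<exists>c'. c' \<in> V \<and> E c c' \<and>
        (c' = r \<or> (\<forall>r'. r' \<in> V \<and> E r r' \<longrightarrow> cop_wins_within V E k c' r')))"

definition cop_wins_in :: "'a set \<Rightarrow> ('a \<Rightarrow> 'a \<Rightarrow> bool) \<Rightarrow> nat \<Rightarrow> bool" where
  "cop_wins_in V E k \<longleftrightarrow> (\<exists>c\<in>V. \<forall>r\<in>V. cop_wins_within V E k c r)"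

definition cop_win :: "'a set \<Rightarrow> ('a \<Rightarrow> 'a \<Rightarrow> bool) \<Rightarrow> bool" where
  "cop_win V E \<longleftrightarrow> (\<exists>k. cop_wins_in V E k)"

definition capture_time :: "'a set \<Rightarrow> ('a \<Rightarrow> 'a \<Rightarrow> bool) \<Rightarrow> nat" where
  "capture_time V E = (LEAST k. cop_wins_in V E k)"

definition nbhd :: "('a \<Rightarrow> 'a \<Rightarrow> bool) \<Rightarrow> 'a set \<Rightarrow> 'a \<Rightarrow> 'a set" where
  "nbhd E S v = {u \<in> S. E v u}"

definition is_clique :: "('a \<Rightarrow> 'a \<Rightarrow> bool) \<Rightarrow> 'a set \<Rightarrow> bool" where
  "is_clique E S \<longleftrightarrow> (\<forall>u\<in>S. \<forall>v\<in>S. E u v)"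

definition strict_corners :: "('a \<Rightarrow> 'a \<Rightarrow> bool) \<Rightarrow> 'a set \<Rightarrow> 'a set" where
  "strict_corners E S = {v \<in> S. \<exists>w\<in>S. w \<noteq> v \<and> nbhd E S v \<subset> nbhd E S w}"

text \<open>layer V E k is the vertex set of G^(k+1); after the clique stage it is empty.\<close>
fun layer :: "'a set \<Rightarrow> ('a \<Rightarrow> 'a \<Rightarrow> bool) \<Rightarrow> nat \<Rightarrow> 'a set" where
  "layer V E 0 = V"
| "layer V E (Suc k) = (if is_clique E (layer V E k) then {}
                        else layer V E k - strict_corners E (layer V E k))"

definition finite_corner_rank :: "'a set \<Rightarrow> ('a \<Rightarrow> 'a \<Rightarrow> bool) \<Rightarrow> bool" where
  "finite_corner_rank V E \<longleftrightarrow> (\<exists>k. is_clique E (layer V E k))"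

definition corner_rank :: "'a set \<Rightarrow> ('a \<Rightarrow> 'a \<Rightarrow> bool) \<Rightarrow> nat" where
  "corner_rank V E = Suc (LEAST k. is_clique E (layer V E k))"

text \<open>X_j, the set of vertices of rank j (for 1 \<le> j \<le> alpha).\<close>
definition rank_set :: "'a set \<Rightarrow> ('a \<Rightarrow> 'a \<Rightarrow> bool) \<Rightarrow> nat \<Rightarrow> 'a set" where
  "rank_set V E j = layer V E (j - 1) - layer V E j"

definition dominates :: "('a \<Rightarrow> 'a \<Rightarrow> bool) \<Rightarrow> 'a \<Rightarrow> 'a set \<Rightarrow> bool" where
  "dominates E v S \<longleftrightarrow> (\<forall>u\<in>S. E v u)"

text \<open>Type 1: some vertex of rank alpha dominates V(G^(alpha-1)) = layer (alpha-2).\<close>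
definition type1 :: "'a set \<Rightarrow> ('a \<Rightarrow> 'a \<Rightarrow> bool) \<Rightarrow> bool" where
  "type1 V E \<longleftrightarrow> (\<exists>v \<in> rank_set V E (corner_rank V E).
      dominates E v (layer V E (corner_rank V E - 2)))"

definition realizes :: "'a set \<Rightarrow> ('a \<Rightarrow> 'a \<Rightarrow> bool) \<Rightarrow> nat \<Rightarrow> nat list \<Rightarrow> bool" where
  "realizes V E r xs \<longleftrightarrow>
     cop_win V E \<and> finite_corner_rank V E \<and> corner_rank V E \<ge> 2 \<and>
     ((r = 1 \<and> type1 V E) \<or> (r = 0 \<and> \<not> type1 V E)) \<and>
     length xs = corner_rank V E \<and>
     (\<forall>i < length xs. xs ! i = card (rank_set V E (corner_rank V E - i)))"

definition standard_extension :: "nat list \<Rightarrow> nat list \<Rightarrow> bool" where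
  "standard_extension ys xs \<longleftrightarrow> (\<exists>m. xs = ys @ replicate m (last ys))"

end

theory Submission
  imports Defs
begin

text \<open>Mapping each strict corner to a non-corner that corners it retracts every layer onto the
  next one. The cop wins by chasing the image of the robber in the deepest layers, and the robber
  survives by climbing one layer per round while avoiding the image of the cop; so a graph of
  corner rank \<open>\<alpha>\<close> and type \<open>r\<close> has capture time \<open>\<alpha> - r\<close>, and capture time \<open>n - 5\<close> says that the
  rank cardinalities exceed 1 by a total of exactly \<open>5 - r\<close>.

  It remains to bound the top cardinalities from below. If level \<open>k\<close> is a single vertex, then
  some vertex of the next layer is adjacent to all of level \<open>k + 1\<close> without cornering any of it.
  Hence the two levels below the top one have at least two vertices each. If moreover the top two
  levels are too small, then, up to two type-0 configurations settled directly, some level contains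
  a pendant vertex together with a vertex far away from it, as at the two ends of a path. This configuration reproduces itself from level to level
  and forces so many further levels to have at least two vertices that the total is exceeded.\<close>

section \<open>Strict corners, bounded-time wins and the retraction along corners\<close>

lemma mem_nbhd: "u \<in> nbhd E S v \<longleftrightarrow> u \<in> S \<and> E v u"
  by (simp add: nbhd_def)

lemma strict_cornersI:
  "v \<in> S \<Longrightarrow> w \<in> S \<Longrightarrow> nbhd E S v \<subset> nbhd E S w \<Longrightarrow> v \<in> strict_corners E S"
  by (auto simp: strict_corners_def)

text \<open>Passing to a vertex that corners \<open>v\<close> enlarges the closed neighborhood,
  whose size is bounded by \<open>card S\<close>; a chain of such steps ends at a
  non-corner.\<close>

lemma strict_corner_witness:
  assumes "finite S" and "v \<in> strict_corners E S"
  shows "\<exists>w \<in> S - strict_corners E S. nbhd E S v \<subset> nbhd E S w"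
  using assms(2)
proof (induction "card S - card (nbhd E S v)" arbitrary: v rule: less_induct)
  case less
  then obtain w where w: "w \<in> S" "nbhd E S v \<subset> nbhd E S w"
    by (auto simp: strict_corners_def)
  show ?case
  proof (cases "w \<in> strict_corners E S")
    case True
    have sub: "nbhd E S w \<subseteq> S" by (auto simp: nbhd_def)
    then have "card (nbhd E S v) < card (nbhd E S w)" "card (nbhd E S w) \<le> card S"
      using w assms(1) by (meson finite_subset psubset_card_mono, meson card_mono)
    then have "card S - card (nbhd E S w) < card S - card (nbhd E S v)" by simp
    from less.hyps[OF this True] w show ?thesis by blast
  qed (use w in blast)
qed

lemma cop_wins_within_Suc: "cop_wins_within V E k c r \<Longrightarrow> cop_wins_within V E (Suc k) c r"
proof (induction k arbitrary: c r)
  case (Suc k)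
  then show ?case by (subst cop_wins_within.simps(2)) (subst (asm) cop_wins_within.simps(2), blast)
qed simp

lemma cop_wins_in_mono:
  assumes "cop_wins_in V E k" and "k \<le> l"
  shows "cop_wins_in V E l"
  using assms(2,1)
proof (induction rule: dec_induct)
  case (step i)
  then show ?case using cop_wins_within_Suc[of V E i] unfolding cop_wins_in_def by blast
qed

lemma capture_time_eqI:
  assumes "cop_wins_in V E (Suc t)" and "\<not> cop_wins_in V E t"
  shows "capture_time V E = Suc t"
  unfolding capture_time_def
proof (rule Least_equality)
  fix y assume "cop_wins_in V E y"
  with assms(2) show "Suc t \<le> y" using cop_wins_in_mono[of V E y t] by (meson not_less_eq_eq)
qed (rule assms(1))

text \<open>Choosing among non-corners makes one application land in the next layer; fixing the
  other vertices makes the map a retraction.\<close>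

definition corner_retract :: "('a \<Rightarrow> 'a \<Rightarrow> bool) \<Rightarrow> 'a set \<Rightarrow> 'a \<Rightarrow> 'a" where
  "corner_retract E S v = (if v \<in> strict_corners E S
     then SOME w. w \<in> S - strict_corners E S \<and> nbhd E S v \<subset> nbhd E S w else v)"

primrec shadow :: "'a set \<Rightarrow> ('a \<Rightarrow> 'a \<Rightarrow> bool) \<Rightarrow> nat \<Rightarrow> 'a \<Rightarrow> 'a" where
  "shadow V E 0 x = x"
| "shadow V E (Suc j) x = corner_retract E (layer V E j) (shadow V E j x)"

lemma corner_retract:
  assumes "finite S" and "v \<in> S"
  shows "corner_retract E S v \<in> S - strict_corners E S"
    and "nbhd E S v \<subseteq> nbhd E S (corner_retract E S v)"
proof -
  have "corner_retract E S v \<in> S - strict_corners E S \<and>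
        nbhd E S v \<subseteq> nbhd E S (corner_retract E S v)"
  proof (cases "v \<in> strict_corners E S")
    case True
    with strict_corner_witness[OF assms(1)]
    have "\<exists>w. w \<in> S - strict_corners E S \<and> nbhd E S v \<subset> nbhd E S w" by blast
    from someI_ex[OF this] True show ?thesis by (simp add: corner_retract_def psubset_eq)
  qed (use assms in \<open>simp add: corner_retract_def\<close>)
  then show "corner_retract E S v \<in> S - strict_corners E S"
    "nbhd E S v \<subseteq> nbhd E S (corner_retract E S v)" by auto
qed

section \<open>Corner rank and capture time\<close>

locale reflexive_graph =
  fixes V :: "'a set" and E :: "'a \<Rightarrow> 'a \<Rightarrow> bool"
  assumes graph: "rgraph V E"
begin

abbreviation "L \<equiv> layer V E"

lemma finite_V: "finite V" and V_nonempty: "V \<noteq> {}"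
  and adj_refl: "v \<in> V \<Longrightarrow> E v v" and adj_sym: "E u v \<Longrightarrow> E v u"
  and adj_in: "E u v \<Longrightarrow> u \<in> V" "E u v \<Longrightarrow> v \<in> V"
  using graph by (auto simp: rgraph_def)

lemma layer_step: "L (Suc k) \<subseteq> L k"
  by auto

lemma layer_antimono: "i \<le> j \<Longrightarrow> L j \<subseteq> L i"
  by (rule lift_Suc_antimono_le) (use layer_step in auto)

lemma layer_in_V: "v \<in> L k \<Longrightarrow> v \<in> V"
  using layer_antimono[of 0 k] by auto

lemma finite_layer: "finite (L k)"
  using finite_V layer_in_V by (meson finite_subset subsetI)

lemma layer_Suc: "\<not> is_clique E (L k) \<Longrightarrow> L (Suc k) = L k - strict_corners E (L k)"
  by simp

lemma layer_Suc_nonempty: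
  assumes "\<not> is_clique E (L k)" shows "L (Suc k) \<noteq> {}"
proof -
  from assms obtain v where "v \<in> L k" by (auto simp: is_clique_def)
  from corner_retract(1)[OF finite_layer this] layer_Suc[OF assms] show ?thesis by blast
qed

lemma corner_retract_near:
  assumes "u \<in> L k" "v \<in> L k" "E u v"
  shows "E (corner_retract E (L k) u) v"
  using corner_retract(2)[OF finite_layer assms(1), of E] assms by (auto simp: mem_nbhd subset_iff)

text \<open>A retraction only enlarges neighborhoods within the layer, so the ends of an edge can be
  moved one after the other: the map is a graph homomorphism.\<close>

lemma corner_retract_adj:
  assumes "u \<in> L k" "v \<in> L k" "E u v"
  shows "E (corner_retract E (L k) u) (corner_retract E (L k) v)"
proof -
  have "E u (corner_retract E (L k) v)"
    using corner_retract_near[OF assms(2,1)] assms(3) adj_sym by blast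
  then show ?thesis
    using corner_retract_near[OF assms(1)] corner_retract(1)[OF finite_layer assms(2)] by blast
qed

lemma shadow_in:
  assumes "\<forall>i<j. \<not> is_clique E (L i)" "x \<in> V"
  shows "shadow V E j x \<in> L j"
  using assms(1)
proof (induction j)
  case (Suc j)
  then have "shadow V E j x \<in> L j" by simp
  from corner_retract(1)[OF finite_layer this] Suc.prems show ?case
    by (metis layer_Suc lessI shadow.simps(2))
qed (use assms(2) in simp)

lemma shadow_id:
  assumes "\<forall>i<j. \<not> is_clique E (L i)" "x \<in> L j"
  shows "shadow V E j x = x"
  using assms
proof (induction j)
  case (Suc j)
  then have "x \<in> L j" "x \<notin> strict_corners E (L j)" by (auto split: if_splits)
  with Suc show ?case by (simp add: corner_retract_def)
qed simp

lemma shadow_adj: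
  assumes "\<forall>i<j. \<not> is_clique E (L i)" "E x y"
  shows "E (shadow V E j x) (shadow V E j y)"
  using assms(1)
proof (induction j)
  case (Suc j)
  then have "shadow V E j x \<in> L j" "shadow V E j y \<in> L j"
    using shadow_in assms(2) adj_in by auto
  with Suc show ?case by (simp add: corner_retract_adj)
qed (use assms(2) in simp)

text \<open>The robber retreats one layer per round, always keeping away from the shadow of the cop.\<close>

lemma robber_evades:
  assumes "\<forall>i<j. \<not> is_clique E (L i)" "c \<in> V" "r \<in> L j" "\<not> E (shadow V E j c) r"
  shows "\<not> cop_wins_within V E (Suc j) c r"
  using assms
proof (induction j arbitrary: c r)
  case 0
  then have "r \<in> V" "\<not> E c r" by auto
  then show ?case using adj_refl by auto
next
  case (Suc j)
  have nc: "\<forall>i<j. \<not> is_clique E (L i)" "\<not> is_clique E (L j)" using Suc.prems by auto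
  have r: "r \<in> V" "r \<in> L j" "r \<notin> strict_corners E (L j)"
    using Suc.prems layer_in_V nc(2) by auto
  have ncr: "\<not> E c r"
    using shadow_adj[OF Suc.prems(1), of c r] shadow_id[OF Suc.prems(1,3)] Suc.prems(4) by auto
  have "\<exists>r'. r' \<in> V \<and> E r r' \<and> \<not> cop_wins_within V E (Suc j) c' r'" if c': "E c c'" for c'
  proof -
    let ?d = "shadow V E j c'" and ?e = "shadow V E j c"
    have V: "c' \<in> V" using c' adj_in by auto
    have d: "?d \<in> L j" "?e \<in> L j" using shadow_in[OF nc(1)] V Suc.prems(2) by auto
    \<comment> \<open>Otherwise \<open>r\<close>, not being a strict corner, has the same
      neighborhood in \<open>L j\<close> as the new cop shadow \<open>?d\<close>. The old shadow
      \<open>?e\<close> is adjacent to \<open>?d\<close>, hence to \<open>r\<close>, and one more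
      retraction, which fixes \<open>r\<close>, contradicts the hypothesis.\<close>
    have "\<exists>r'\<in>L j. E r r' \<and> \<not> E ?d r'"
    proof (rule ccontr)
      assume "\<not> ?thesis"
      then have "nbhd E (L j) r \<subseteq> nbhd E (L j) ?d" by (auto simp: mem_nbhd)
      then have "nbhd E (L j) r = nbhd E (L j) ?d"
        using r d by (cases "?d = r") (auto simp: strict_corners_def psubset_eq)
      moreover have "E ?d ?e" using shadow_adj[OF nc(1)] c' adj_sym by blast
      ultimately have "E ?e r" using d by (auto simp: mem_nbhd set_eq_iff intro: adj_sym)
      then have "E (corner_retract E (L j) ?e) (corner_retract E (L j) r)"
        using corner_retract_adj d r by blast
      then show False using Suc.prems(4) r(3) by (simp add: corner_retract_def)
    qed
    then obtain r' where "r' \<in> L j" "E r r'" "\<not> E ?d r'" by blast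
    with Suc.IH[OF nc(1) V] adj_in show ?thesis by blast
  qed
  then show ?case using ncr r adj_refl by (subst cop_wins_within.simps(2)) blast
qed

text \<open>The robber starts at a vertex of \<open>L j\<close> that the shadow of the cop does not
  reach.\<close>

lemma not_cop_wins_in:
  assumes "\<forall>i<j. \<not> is_clique E (L i)" "\<not> (\<exists>d\<in>L j. dominates E d (L j))"
  shows "\<not> cop_wins_in V E (Suc j)"
proof
  assume "cop_wins_in V E (Suc j)"
  then obtain c where c: "c \<in> V" "\<forall>r\<in>V. cop_wins_within V E (Suc j) c r"
    unfolding cop_wins_in_def by blast
  have "shadow V E j c \<in> L j" using shadow_in assms(1) c by blast
  with assms(2) obtain r where "r \<in> L j" "\<not> E (shadow V E j c) r" by (auto simp: dominates_def)
  with robber_evades[OF assms(1) c(1)] c(2) layer_in_V show False by blast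
qed

text \<open>A vertex with less than the full neighborhood is strictly cornered by \<open>d\<close>,
  so every survivor is adjacent to all of \<open>L j\<close>.\<close>

lemma dominated_layer_Suc_clique:
  assumes "d \<in> L j" "dominates E d (L j)"
  shows "is_clique E (L (Suc j))"
proof -
  have d: "nbhd E (L j) d = L j" using assms by (auto simp: nbhd_def dominates_def)
  have "nbhd E (L j) x = L j" if "x \<in> L j" "x \<notin> strict_corners E (L j)" for x
  proof (cases "x = d")
    case False
    moreover have "nbhd E (L j) x \<subseteq> nbhd E (L j) d" unfolding d by (auto simp: nbhd_def)
    moreover have "\<not> nbhd E (L j) x \<subset> nbhd E (L j) d"
      using that assms(1) False by (auto simp: strict_corners_def)
    ultimately show ?thesis using d by blast
  qed (simp add: d)
  then have "E x y" if "x \<in> L (Suc j)" "y \<in> L (Suc j)" for x y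
    using that mem_nbhd[of y E "L j" x] by (auto split: if_splits)
  then show ?thesis unfolding is_clique_def by blast
qed

text \<open>If no layer were a clique, no layer would have a dominating vertex, and the robber could
  evade for any number of moves.\<close>

lemma cop_win_finite_corner_rank:
  assumes "cop_win V E"
  shows "finite_corner_rank V E"
proof (rule ccontr)
  assume "\<not> ?thesis"
  then have nc: "\<not> is_clique E (L k)" for k by (auto simp: finite_corner_rank_def)
  obtain k where "cop_wins_in V E k" using assms by (auto simp: cop_win_def)
  then have "cop_wins_in V E (Suc k)" using cop_wins_in_mono by (metis le_SucI order_refl)
  then show False using not_cop_wins_in dominated_layer_Suc_clique nc by blast
qed

text \<open>The cop plays in \<open>L (Suc j)\<close> against the image of the robber. Once the
  image is caught, every next position of the robber is adjacent to the cop, so one extra move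
  suffices.\<close>

lemma cop_wins_within_lift:
  assumes "\<not> is_clique E (L j)" "c \<in> L (Suc j)" "r \<in> L j"
    "cop_wins_within (L (Suc j)) E k c (corner_retract E (L j) r)"
  shows "cop_wins_within (L j) E (Suc k) c r"
  using assms(2-4)
proof (induction k arbitrary: c r)
  case 0
  then have "E c r" using corner_retract_near[OF 0(2,2)] adj_refl layer_in_V by simp
  with 0 show ?case by auto
next
  case (Suc k)
  let ?f = "corner_retract E (L j)"
  have near: "cop_wins_within (L j) E (Suc l) (?f r) r'" if "r' \<in> L j" "E r r'" for r' l
    using that corner_retract_near[OF Suc.prems(2)] by auto
  have rr: "E r r" using Suc.prems adj_refl layer_in_V by blast
  from Suc.prems(3) consider "c = ?f r"
    | c' where "c' \<in> L (Suc j)" "E c c'" "c' = ?f r"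
    | c' where "c' \<in> L (Suc j)" "E c c'"
        "\<forall>r'. r' \<in> L (Suc j) \<and> E (?f r) r' \<longrightarrow> cop_wins_within (L (Suc j)) E k c' r'"
    by (subst (asm) cop_wins_within.simps(2)) blast
  then show ?case
  proof cases
    case 1
    show ?thesis unfolding 1 by (rule near[OF Suc.prems(2) rr])
  next
    case 2
    with near layer_step show ?thesis by (subst cop_wins_within.simps(2)) blast
  next
    case 3
    have "cop_wins_within (L j) E (Suc k) c' r'" if "r' \<in> L j" "E r r'" for r'
      using Suc.IH[OF 3(1) that(1)] 3(3) corner_retract_adj[OF Suc.prems(2) that]
        corner_retract(1)[OF finite_layer that(1)] layer_Suc[OF assms(1)] by auto
    with 3 layer_step show ?thesis by (subst cop_wins_within.simps(2)) blast
  qed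
qed

lemma cop_wins_in_lift:
  assumes "\<forall>i<j. \<not> is_clique E (L i)" "cop_wins_in (L j) E k"
  shows "cop_wins_in V E (j + k)"
  using assms
proof (induction j arbitrary: k)
  case (Suc j)
  then have nc: "\<not> is_clique E (L j)" by simp
  from Suc.prems(2) obtain c where c: "c \<in> L (Suc j)"
    "\<forall>r\<in>L (Suc j). cop_wins_within (L (Suc j)) E k c r" by (auto simp: cop_wins_in_def)
  have "cop_wins_within (L j) E (Suc k) c r" if "r \<in> L j" for r
    using cop_wins_within_lift[OF nc c(1) that] c(2) corner_retract(1)[OF finite_layer that]
      layer_Suc[OF nc] by auto
  then have "cop_wins_in (L j) E (Suc k)" using c(1) layer_step unfolding cop_wins_in_def by blast
  with Suc show ?case by fastforce
qed simp

end

declare layer.simps(2) [simp del]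

section \<open>Bounds on rank cardinalities\<close>

text \<open>Indices start at 0: the top clique is \<open>L m\<close>, the corner rank is
  \<open>m + 1\<close>, and for \<open>k \<le> m\<close> the set \<open>level k\<close> defined
  below consists of the vertices of rank \<open>k + 1\<close>.\<close>

locale corner_ranked = reflexive_graph V E for V :: "'a set" and E +
  fixes m :: nat
  assumes clique_top: "is_clique E (L m)"
    and not_clique: "k < m \<Longrightarrow> \<not> is_clique E (L k)"
begin

abbreviation level :: "nat \<Rightarrow> 'a set" where
  "level k \<equiv> L k - L (Suc k)"

abbreviation corners :: "nat \<Rightarrow> 'a \<Rightarrow> 'a \<Rightarrow> bool" where
  "corners k c a \<equiv> nbhd E (L k) a \<subset> nbhd E (L k) c"

lemma layer_Suc_eq: "k < m \<Longrightarrow> L (Suc k) = L k - strict_corners E (L k)"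
  using layer_Suc not_clique by blast

lemma level_eq: "k < m \<Longrightarrow> level k = strict_corners E (L k)"
  using layer_Suc_eq by (auto simp: strict_corners_def)

lemma level_top: "level m = L m"
  using clique_top by (simp add: layer.simps(2))

lemma in_layer_refl: "v \<in> L k \<Longrightarrow> E v v"
  using adj_refl layer_in_V by blast

lemma cornerer_exists:
  assumes "k < m" "a \<in> level k"
  shows "\<exists>c\<in>L (Suc k). corners k c a \<and> c \<noteq> a \<and> E c a \<and> (\<forall>x\<in>L k. E a x \<longrightarrow> E c x)"
proof -
  obtain c where c: "c \<in> L (Suc k)" "corners k c a"
    using strict_corner_witness[OF finite_layer, of a E k] level_eq[OF assms(1)] assms(2)
      layer_Suc_eq[OF assms(1)] by blast
  moreover have "\<forall>x\<in>L k. E a x \<longrightarrow> E c x"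
    using c(2) by (auto simp: mem_nbhd)
  ultimately show ?thesis using in_layer_refl[of a k] assms(2) by blast
qed

text \<open>Since \<open>a\<close> survives the deletion in \<open>L k\<close>, the vertex
  \<open>c\<close> does not corner it there; a neighbor of \<open>a\<close> that \<open>c\<close>
  misses must lie in the deleted level.\<close>

lemma corner_witness:
  assumes "k < m" "a \<in> L (Suc k)" "c \<in> L (Suc k)" "corners (Suc k) c a"
  shows "\<exists>w\<in>level k. E a w \<and> \<not> E c w"
proof (rule ccontr)
  assume contra: "\<not> ?thesis"
  have sub: "L (Suc k) \<subseteq> L k" by (rule layer_step)
  have "nbhd E (L k) a \<subseteq> nbhd E (L k) c"
  proof
    fix x assume "x \<in> nbhd E (L k) a"
    with contra assms(4) show "x \<in> nbhd E (L k) c"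
      by (cases "x \<in> L (Suc k)") (auto simp: mem_nbhd)
  qed
  moreover obtain x where "x \<in> L (Suc k)" "E c x" "\<not> E a x"
    using assms(4) unfolding psubset_eq by (auto simp: mem_nbhd set_eq_iff)
  then have "x \<in> nbhd E (L k) c" "x \<notin> nbhd E (L k) a" using sub by (auto simp: mem_nbhd)
  ultimately have "corners k c a" by blast
  then have "a \<in> strict_corners E (L k)"
    using assms(2,3) sub by (auto simp: strict_corners_def)
  with assms(2) layer_Suc_eq[OF assms(1)] show False by blast
qed

text \<open>The witness from \<open>corner_witness\<close> can only be the single vertex
  \<open>w\<close>, so \<open>w\<close> is adjacent to every \<open>a\<close>. A vertex
  \<open>z\<close> cornering \<open>w\<close> is then adjacent to each \<open>a\<close>, and it
  cannot corner \<open>a\<close> because it sees \<open>w\<close>.\<close>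

lemma level_single:
  assumes "Suc k < m" "card (level k) = 1"
  shows "\<exists>z\<in>L (Suc k). \<forall>a\<in>level (Suc k). E z a \<and> \<not> corners (Suc k) z a"
proof -
  obtain w where w: "level k = {w}" using assms(2) card_1_singletonE by blast
  obtain z where z: "z \<in> L (Suc k)" "E z w" "\<forall>x\<in>L k. E w x \<longrightarrow> E z x"
    using cornerer_exists[of k w] assms(1) w by auto
  have "E z a \<and> \<not> corners (Suc k) z a" if a: "a \<in> level (Suc k)" for a
  proof -
    have ak: "a \<in> L (Suc k)" "a \<in> L k" using a layer_step[of k] by blast+
    obtain c where "c \<in> L (Suc k)" "corners (Suc k) c a"
      using cornerer_exists[OF assms(1) a] layer_step[of "Suc k"] by blast
    then have "E a w" using corner_witness[of k a c] ak assms(1) w by auto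
    then have "E z a" using z ak adj_sym by blast
    moreover have "\<not> corners (Suc k) z a"
      using corner_witness[of k a z] ak z assms(1) w by auto
    ultimately show ?thesis by blast
  qed
  with z show ?thesis by blast
qed

lemma level_not_dominates:
  assumes "k < m" "a \<in> level k" shows "\<not> dominates E a (L k)"
proof -
  obtain c where "corners k c a" using cornerer_exists[OF assms] by blast
  then show ?thesis by (auto simp: dominates_def mem_nbhd)
qed

lemma dominates_corners:
  assumes "k < m" "a \<in> level k" "dominates E c (L k)" shows "corners k c a"
  using level_not_dominates[OF assms(1,2)] assms(3) by (auto simp: dominates_def mem_nbhd psubset_eq)

lemma finite_level: "finite (level k)"
  using finite_layer by blast

lemma top_nonempty: "L m \<noteq> {}"
proof (cases m)
  case (Suc k)
  then show ?thesis using layer_Suc_nonempty[of k] not_clique[of k] by simp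
qed (use V_nonempty in simp)

text \<open>A layer without strict corners repeats forever, so the clique \<open>L m\<close> would
  never be reached.\<close>

lemma level_nonempty:
  assumes "k \<le> m" shows "level k \<noteq> {}"
proof (cases "k = m")
  case True
  then show ?thesis using level_top top_nonempty by simp
next
  case False
  then have k: "k < m" using assms by simp
  show ?thesis
  proof
    assume "level k = {}"
    then have "strict_corners E (L k) = {}" using level_eq[OF k] by blast
    then have "L (k + i) = L k" for i
      by (induction i) (use not_clique[OF k] in \<open>simp_all add: layer_Suc\<close>)
    from this[of "m - k"] k show False using not_clique[OF k] clique_top by simp
  qed
qed

lemma card_level_pos: "k \<le> m \<Longrightarrow> 1 \<le> card (level k)"
  using level_nonempty[of k] finite_level[of k] by (metis One_nat_def Suc_leI card_gt_0_iff)

lemma sum_card_levels: "(\<Sum>j\<le>m. card (level j)) = card V"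
proof -
  have "(\<Sum>j<k. card (level j)) + card (L k) = card V" for k
  proof (induction k)
    case (Suc k)
    have "card (level k) + card (L (Suc k)) = card (L k)"
      using card_Diff_subset[OF finite_layer layer_step] card_mono[OF finite_layer layer_step]
      by (metis le_add_diff_inverse2)
    with Suc show ?case by simp
  qed simp
  from this[of m] show ?thesis by (simp add: level_top lessThan_Suc_atMost[symmetric])
qed

text \<open>The \<open>q\<close> lowest levels are counted with one vertex each, which leaves the
  budget for the six top levels.\<close>

lemma six_levels:
  assumes "m = Suc (Suc (Suc (Suc (Suc q))))"
  shows "card (level m) + card (level (Suc (Suc (Suc (Suc q))))) + card (level (Suc (Suc (Suc q))))
    + card (level (Suc (Suc q))) + card (level (Suc q)) + card (level q) + q \<le> card V"
proof -
  have "(\<Sum>j<q. 1) \<le> (\<Sum>j<q. card (level j))"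
    using card_level_pos assms by (intro sum_mono) simp
  then show ?thesis
    using sum_card_levels by (simp add: assms lessThan_Suc_atMost[symmetric])
qed

lemma two_le_cardI: "x \<in> level k \<Longrightarrow> y \<in> level k \<Longrightarrow> x \<noteq> y \<Longrightarrow> 2 \<le> card (level k)"
  using card_mono[OF finite_level, of "{x, y}" k] by simp

lemma two_le_card: "k \<le> m \<Longrightarrow> card (level k) \<noteq> 1 \<Longrightarrow> 2 \<le> card (level k)"
  using card_level_pos[of k] by linarith

section \<open>Pendant vertices, tips and their descent through the levels\<close>

definition pendant :: "nat \<Rightarrow> 'a \<Rightarrow> 'a \<Rightarrow> bool" where
  "pendant k b c \<longleftrightarrow> b \<in> level k \<and> nbhd E (L k) b = {b, c} \<and> b \<noteq> c"

text \<open>Unlike a pendant vertex, a tip may have further neighbors in its own level.\<close>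

definition tip :: "nat \<Rightarrow> 'a \<Rightarrow> 'a \<Rightarrow> bool" where
  "tip k w b \<longleftrightarrow> w \<in> level k \<and> nbhd E (L (Suc k)) w = {b}"

text \<open>A common neighbour of \<open>a\<close> and \<open>b\<close> can only be \<open>c\<close>, and is harmless if it corners \<open>a\<close>: the
  vertex below that keeps \<open>a\<close> from being cornered is then not adjacent to \<open>c\<close>.\<close>

definition pendant_apart :: "nat \<Rightarrow> 'a \<Rightarrow> 'a \<Rightarrow> 'a \<Rightarrow> bool" where
  "pendant_apart k a b c \<longleftrightarrow> pendant k b c \<and> a \<in> level k \<and> \<not> E a b \<and> (E a c \<longrightarrow> corners k c a)"

text \<open>A stronger form of \<open>pendant_apart\<close> that tolerates three vertices in the
  level below. The neighbors \<open>c\<close> and \<open>d\<close> may coincide, as they do under a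
  single top vertex.\<close>

definition two_pendants :: "nat \<Rightarrow> bool" where
  "two_pendants k \<longleftrightarrow> (\<exists>a b c d. pendant k a c \<and> pendant k b d \<and> \<not> E a b)"

lemma pendantD:
  assumes "k < m" "pendant k b c"
  shows "c \<in> L (Suc k)" "corners k c b" "E b c" "\<And>x. x \<in> L k \<Longrightarrow> E b x \<Longrightarrow> x = b \<or> x = c"
proof -
  have b: "b \<in> level k" "nbhd E (L k) b = {b, c}" using assms(2) by (auto simp: pendant_def)
  show nb: "x = b \<or> x = c" if "x \<in> L k" "E b x" for x
    using that b(2) by (auto simp: mem_nbhd set_eq_iff)
  obtain y where "y \<in> L (Suc k)" "corners k y b" "y \<noteq> b" "E y b" using cornerer_exists[OF assms(1) b(1)] by blast
  with nb[of y] layer_step[of k] adj_sym show "c \<in> L (Suc k)" "corners k c b" "E b c" by blast+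
qed

lemma tipD:
  assumes "tip k w b"
  shows "w \<in> level k" "\<And>x. x \<in> L (Suc k) \<Longrightarrow> E w x \<Longrightarrow> x = b"
proof -
  show "w \<in> level k" using assms unfolding tip_def by blast
  fix x assume "x \<in> L (Suc k)" "E w x"
  then have "x \<in> nbhd E (L (Suc k)) w" by (simp add: mem_nbhd)
  then show "x = b" using assms by (simp add: tip_def)
qed

lemma tip_cornerer:
  assumes "k < m" "tip k w b"
  shows "corners k b w" "b \<in> L (Suc k)" "E b w" "\<And>x. x \<in> L k \<Longrightarrow> E w x \<Longrightarrow> E b x"
proof -
  note w = tipD[OF assms(2)]
  obtain y where y: "y \<in> L (Suc k)" "corners k y w" "y \<noteq> w" "E y w"
    "\<And>x. x \<in> L k \<Longrightarrow> E w x \<Longrightarrow> E y x"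
    using cornerer_exists[OF assms(1) w(1)] by blast
  then have "y = b" using w adj_sym by blast
  with y show "corners k b w" "b \<in> L (Suc k)" "E b w" "\<And>x. x \<in> L k \<Longrightarrow> E w x \<Longrightarrow> E b x" by blast+
qed

text \<open>Take for \<open>w\<close> a neighbor of \<open>b\<close> in \<open>level k\<close> that
  \<open>c\<close> misses. A vertex cornering \<open>w\<close> is adjacent to \<open>b\<close>,
  hence is \<open>b\<close> or \<open>c\<close>, hence is \<open>b\<close>. So the neighbors of
  \<open>w\<close> in the next layer are among \<open>b\<close> and \<open>c\<close>, and
  \<open>c\<close> is excluded.\<close>

lemma pendant_tip:
  assumes "Suc k < m" "pendant (Suc k) b c"
  shows "\<exists>w. tip k w b"
proof -
  have k: "k < m" using assms(1) by simp
  have b: "b \<in> L (Suc k)" using assms(2) by (simp add: pendant_def)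
  have c: "c \<in> L (Suc k)" "corners (Suc k) c b"
    using pendantD[OF assms] layer_step[of "Suc k"] by blast+
  from corner_witness[OF k b c] obtain w where w: "w \<in> level k" "E b w" "\<not> E c w" by blast
  obtain y where y: "y \<in> L (Suc k)" "E y w" "\<And>x. x \<in> L k \<Longrightarrow> E w x \<Longrightarrow> E y x"
    using cornerer_exists[OF k w(1)] by blast
  have "E b y" using y(3)[of b] b w(2) layer_step[of k] adj_sym by blast
  with y w have "y = b" using pendantD(4)[OF assms, of y] by blast
  have "x = b" if "x \<in> L (Suc k)" "E w x" for x
  proof -
    have "E b x" using that y(3) \<open>y = b\<close> layer_step[of k] by blast
    then show ?thesis using pendantD(4)[OF assms that(1)] that w(3) adj_sym by blast
  qed
  then have "nbhd E (L (Suc k)) w = {b}" using b adj_sym[OF w(2)] unfolding set_eq_iff mem_nbhd by blast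
  with w(1) show ?thesis unfolding tip_def by blast
qed

text \<open>With a single vertex in \<open>level k\<close>, \<open>level_single\<close> gives a
  common neighbor of \<open>w\<close> and \<open>v\<close>, which can be moved into
  \<open>L (Suc (Suc k))\<close>. There the only neighbor of \<open>w\<close> is \<open>b\<close>,
  and \<open>b\<close> misses \<open>v\<close>.\<close>

lemma tip_card_below:
  assumes "Suc k < m" "tip (Suc k) w b" "v \<in> level (Suc k)" "\<not> E b v"
  shows "2 \<le> card (level k)"
proof (rule two_le_card)
  show "card (level k) \<noteq> 1"
  proof
    assume "card (level k) = 1"
    then obtain z where z: "z \<in> L (Suc k)" "E z w" "E z v"
      using level_single[OF assms(1)] tipD(1)[OF assms(2)] assms(3) by blast
    show False
    proof (cases "z \<in> L (Suc (Suc k))")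
      case True
      then have "z = b" using tipD(2)[OF assms(2)] z adj_sym by blast
      with z assms show False by blast
    next
      case False
      then obtain y where y: "y \<in> L (Suc (Suc k))" "\<And>x. x \<in> L (Suc k) \<Longrightarrow> E z x \<Longrightarrow> E y x"
        using cornerer_exists[OF assms(1), of z] z(1) by blast
      then have "E y w" "E y v" using z tipD(1)[OF assms(2)] assms(3) by blast+
      moreover from this(1) have "y = b" using tipD(2)[OF assms(2) y(1)] adj_sym by blast
      ultimately show False using assms(4) by blast
    qed
  qed
qed (use assms in simp)

text \<open>Take \<open>w\<close> as the tip at \<open>b\<close> and \<open>v\<close> as a neighbor
  that keeps \<open>a\<close> from being cornered, chosen off \<open>c\<close> when \<open>a\<close>
  sees \<open>c\<close>. Were \<open>b\<close> adjacent to \<open>v\<close>, a vertex cornering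
  \<open>v\<close> would be a common neighbor of \<open>a\<close> and \<open>b\<close>, that is
  \<open>c\<close>, contrary to the choice of \<open>v\<close>.\<close>

lemma pendant_apart_step:
  assumes "Suc k < m" "pendant_apart (Suc k) a b c"
  shows "\<exists>v w. tip k w b \<and> v \<in> level k \<and> \<not> E b v"
proof -
  have k: "k < m" using assms(1) by simp
  have p: "pendant (Suc k) b c" and a: "a \<in> level (Suc k)" "\<not> E a b" "E a c \<Longrightarrow> corners (Suc k) c a"
    using assms(2) by (auto simp: pendant_apart_def)
  have aL: "a \<in> L (Suc k)" using a by blast
  have bL: "b \<in> L (Suc k)" using p by (simp add: pendant_def)
  have cL: "c \<in> L (Suc k)" using pendantD[OF assms(1) p] layer_step[of "Suc k"] by blast
  obtain w where w: "tip k w b" using pendant_tip[OF assms(1) p] by blast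
  have "\<exists>v\<in>level k. E a v \<and> (E a c \<longrightarrow> \<not> E c v)"
  proof (cases "E a c")
    case True
    then show ?thesis using corner_witness[OF k aL cL] a(3) by blast
  next
    case False
    obtain d where "d \<in> L (Suc k)" "corners (Suc k) d a"
      using cornerer_exists[OF assms(1) a(1)] layer_step[of "Suc k"] by blast
    with corner_witness[OF k aL] False show ?thesis by blast
  qed
  then obtain v where v: "v \<in> level k" "E a v" "E a c \<Longrightarrow> \<not> E c v" by blast
  have "\<not> E b v"
  proof
    assume bv: "E b v"
    obtain y where y: "y \<in> L (Suc k)" "E y v" "\<And>x. x \<in> L k \<Longrightarrow> E v x \<Longrightarrow> E y x"
      using cornerer_exists[OF k v(1)] by blast
    have "E y a" "E y b" using y(3) aL bL layer_step[of k] v(2) bv adj_sym by blast+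
    then have "y = c" using pendantD(4)[OF assms(1) p y(1)] a(2) adj_sym by blast
    with v(3) y(2) \<open>E y a\<close> adj_sym show False by blast
  qed
  with w v show ?thesis by blast
qed

lemma pendant_apart_card:
  assumes "Suc k < m" "pendant_apart (Suc k) a b c"
  shows "2 \<le> card (level k)"
proof -
  obtain v w where "tip k w b" "v \<in> level k" "\<not> E b v" using pendant_apart_step[OF assms] by blast
  moreover then have "v \<noteq> w" using tip_cornerer[of k w b] assms(1) by auto
  ultimately show ?thesis using two_le_cardI tipD(1) by blast
qed

lemma pendant_apart_card2:
  assumes "Suc (Suc k) < m" "pendant_apart (Suc (Suc k)) a b c"
  shows "2 \<le> card (level k)"
proof -
  obtain v w where "tip (Suc k) w b" "v \<in> level (Suc k)" "\<not> E b v"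
    using pendant_apart_step[OF assms] by blast
  then show ?thesis using tip_card_below Suc_lessD[OF assms(1)] by blast
qed

lemma tip_pendant:
  assumes "k < m" "tip k w b" "\<And>x. x \<in> level k \<Longrightarrow> E w x \<Longrightarrow> x = w"
  shows "pendant k w b"
proof -
  have "w \<in> level k" by (rule tipD(1)[OF assms(2)])
  moreover have b: "b \<in> L (Suc k)" "E b w" using tip_cornerer[OF assms(1,2)] by blast+
  moreover have "nbhd E (L k) w = {w, b}"
  proof (intro equalityI subsetI)
    fix x assume "x \<in> nbhd E (L k) w"
    then have "x \<in> L k" "E w x" by (auto simp: mem_nbhd)
    then show "x \<in> {w, b}" using assms(3)[of x] tipD(2)[OF assms(2), of x] by blast
  next
    fix x assume "x \<in> {w, b}"
    then show "x \<in> nbhd E (L k) w"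
      using b layer_step[of k] \<open>w \<in> level k\<close> in_layer_refl[of w k] adj_sym
      unfolding mem_nbhd by blast
  qed
  ultimately show ?thesis unfolding pendant_def by blast
qed

text \<open>As \<open>b\<close> corners \<open>w\<close> but misses \<open>v\<close>, the vertices
  \<open>v\<close> and \<open>w\<close> are not adjacent. With only these two in the level,
  \<open>w\<close> is pendant and the configuration reappears.\<close>

lemma pendant_apart_pair:
  assumes "Suc k < m" "pendant_apart (Suc k) a b c" "card (level k) = 2"
  shows "\<exists>a b c. pendant_apart k a b c"
proof -
  have k: "k < m" using assms(1) by simp
  obtain v w where vw: "tip k w b" "v \<in> level k" "\<not> E b v"
    using pendant_apart_step[OF assms(1,2)] by blast
  have nvw: "\<not> E w v" using tip_cornerer(4)[OF k vw(1), of v] vw by blast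
  have "v \<noteq> w" using tip_cornerer[OF k vw(1)] vw by blast
  then have "level k = {v, w}"
    using card_subset_eq[OF finite_level, of "{v, w}" k] assms(3) vw(2) tipD(1)[OF vw(1)] by simp
  then have "x = w" if "x \<in> level k" "E w x" for x using that nvw by auto
  then have "pendant k w b" by (rule tip_pendant[OF k vw(1)])
  then have "pendant_apart k v w b" using vw nvw adj_sym unfolding pendant_apart_def by blast
  then show ?thesis by blast
qed

text \<open>If \<open>a\<close> is adjacent to \<open>d\<close>, then \<open>d\<close> is the only
  neighbor \<open>c\<close> of \<open>a\<close> and corners it; this is the exception that
  \<open>pendant_apart\<close> admits.\<close>

lemma two_pendants_apart:
  assumes "k < m" "two_pendants k"
  shows "\<exists>a b c. pendant_apart k a b c"
proof -
  obtain a b c d where p: "pendant k a c" "pendant k b d" "\<not> E a b"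
    using assms(2) unfolding two_pendants_def by blast
  have d: "d \<in> L k" "E b d" using pendantD(1,3)[OF assms(1) p(2)] layer_step[of k] by blast+
  have "E a d \<longrightarrow> corners k d a"
    using pendantD(2)[OF assms(1) p(1)] pendantD(4)[OF assms(1) p(1) d(1)] d(2) p(3) adj_sym by blast
  then have "pendant_apart k a b d" using p unfolding pendant_apart_def pendant_def by blast
  then show ?thesis by blast
qed

text \<open>There are tips \<open>s\<close> at \<open>a\<close> and \<open>t\<close> at
  \<open>b\<close>. The third vertex \<open>u\<close> of the level sees at most one of them, so the
  other one is pendant.\<close>

lemma two_pendants_triple:
  assumes "Suc k < m" "two_pendants (Suc k)" "card (level k) = 3"
  shows "\<exists>a b c. pendant_apart k a b c"
proof -
  have k: "k < m" using assms(1) by simp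
  obtain a b c d where p: "pendant (Suc k) a c" "pendant (Suc k) b d" "\<not> E a b"
    using assms(2) unfolding two_pendants_def by blast
  obtain s t where s: "tip k s a" and t: "tip k t b" using pendant_tip[OF assms(1)] p by blast
  have ab: "a \<in> L (Suc k)" "b \<in> L (Suc k)" "a \<noteq> b"
    using p in_layer_refl unfolding pendant_def by blast+
  have st: "s \<in> level k" "t \<in> level k" using s t tipD(1) by blast+
  have n: "\<not> E a t" "\<not> E b s" using tipD(2)[OF s] tipD(2)[OF t] ab adj_sym by blast+
  then have nst: "\<not> E t s" "\<not> E s t" "s \<noteq> t"
    using tip_cornerer(4)[OF k s] tip_cornerer(4)[OF k t] tip_cornerer(3)[OF k s] st by blast+
  have "card (level k - {s, t}) = 1"
    using assms(3) st nst by (simp add: card_Diff_subset)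
  then obtain u where "level k - {s, t} = {u}" using card_1_singletonE by blast
  then have u: "level k = {s, t, u}" using st by blast
  \<comment> \<open>A vertex cornering \<open>u\<close> would be a neighbor of both tips in the next
    layer, hence equal to both \<open>a\<close> and \<open>b\<close>.\<close>
  have "\<not> (E u s \<and> E u t)"
  proof
    assume us: "E u s \<and> E u t"
    obtain y where y: "y \<in> L (Suc k)" "\<And>x. x \<in> L k \<Longrightarrow> E u x \<Longrightarrow> E y x"
      using cornerer_exists[OF k, of u] u by blast
    then have "E s y" "E t y" using us st adj_sym by blast+
    then show False using tipD(2)[OF s y(1)] tipD(2)[OF t y(1)] ab(3) by blast
  qed
  then consider "\<not> E t u" | "\<not> E s u" using adj_sym by blast
  then show ?thesis
  proof cases
    case 1
    then have "x = t" if "x \<in> level k" "E t x" for x using that u nst by auto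
    then have "pendant k t b" by (rule tip_pendant[OF k t])
    then have "pendant_apart k s t b" using st nst n adj_sym unfolding pendant_apart_def by blast
    then show ?thesis by blast
  next
    case 2
    then have "x = s" if "x \<in> level k" "E s x" for x using that u nst by auto
    then have "pendant k s a" by (rule tip_pendant[OF k s])
    then have "pendant_apart k t s a" using st nst n adj_sym unfolding pendant_apart_def by blast
    then show ?thesis by blast
  qed
qed

text \<open>If the first level down has two vertices, the configuration reappears there and all
  three levels have at least two; otherwise the sizes are at least 3, 2 and 1.\<close>

lemma pendant_apart_three_levels:
  assumes "Suc (Suc (Suc k)) < m" "pendant_apart (Suc (Suc (Suc k))) a b c"
  shows "6 \<le> card (level (Suc (Suc k))) + card (level (Suc k)) + card (level k)"
proof (cases "card (level (Suc (Suc k))) = 2")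
  case True
  then obtain a' b' c' where "pendant_apart (Suc (Suc k)) a' b' c'"
    using pendant_apart_pair[OF assms] by blast
  then show ?thesis
    using pendant_apart_card[OF assms] pendant_apart_card2[OF assms] pendant_apart_card2[of k a' b' c']
      assms(1) by linarith
next
  case False
  then show ?thesis
    using pendant_apart_card[OF assms] pendant_apart_card2[OF assms] card_level_pos[of k] assms(1)
    by linarith
qed

text \<open>A first level of two or three vertices contains the configuration again, giving at least
  2 + 6; otherwise the sizes are at least 4, 2, 1 and 1.\<close>

lemma two_pendants_four_levels:
  assumes "Suc (Suc (Suc (Suc k))) < m" "two_pendants (Suc (Suc (Suc (Suc k))))"
  shows "8 \<le> card (level (Suc (Suc (Suc k)))) + card (level (Suc (Suc k)))
    + card (level (Suc k)) + card (level k)"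
proof -
  obtain a b c where q: "pendant_apart (Suc (Suc (Suc (Suc k)))) a b c"
    using two_pendants_apart[OF assms] by blast
  consider "card (level (Suc (Suc (Suc k)))) = 2 \<or> card (level (Suc (Suc (Suc k)))) = 3"
    | "4 \<le> card (level (Suc (Suc (Suc k))))"
    using pendant_apart_card[OF assms(1) q] by linarith
  then show ?thesis
  proof cases
    case 1
    then obtain a' b' c' where "pendant_apart (Suc (Suc (Suc k))) a' b' c'"
      using pendant_apart_pair[OF assms(1) q] two_pendants_triple[OF assms] by blast
    then have "6 \<le> card (level (Suc (Suc k))) + card (level (Suc k)) + card (level k)"
      using pendant_apart_three_levels assms(1) Suc_lessD by blast
    with 1 show ?thesis by linarith
  next
    case 2
    then show ?thesis
      using pendant_apart_card2[OF assms(1) q] card_level_pos[of k] card_level_pos[of "Suc k"] assms(1)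
      by linarith
  qed
qed

lemma pendantI:
  assumes "b \<in> level k" "c \<in> L k" "c \<noteq> b" "E b c" "\<And>x. x \<in> L k \<Longrightarrow> E b x \<Longrightarrow> x = b \<or> x = c"
  shows "pendant k b c"
proof -
  have "nbhd E (L k) b = {b, c}"
    using assms in_layer_refl[of b k] unfolding set_eq_iff mem_nbhd by blast
  then show ?thesis using assms(1,3) unfolding pendant_def by blast
qed

lemma cornersD:
  assumes "corners k c a" "a \<in> L k"
  shows "E c a" "\<And>x. x \<in> L k \<Longrightarrow> E a x \<Longrightarrow> E c x"
proof -
  show *: "E c x" if "x \<in> L k" "E a x" for x
    using assms(1) that mem_nbhd[of x E "L k"] by blast
  show "E c a" using * assms(2) in_layer_refl by blast
qed

lemma layer_eq_level: "L k = L (Suc k) \<union> level k"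
  using layer_step by blast

lemma level_nonneighbour:
  assumes "k < m" "a \<in> level k" shows "\<exists>x\<in>L k. \<not> E a x"
  using level_not_dominates[OF assms] unfolding dominates_def by blast

section \<open>The top clique and the two levels below it\<close>

lemma top_adj: "u \<in> L m \<Longrightarrow> v \<in> L m \<Longrightarrow> E u v"
  using clique_top by (simp add: is_clique_def)

lemma penultimate_layer: "m = Suc p \<Longrightarrow> L p = L m \<union> level p"
  using layer_eq_level[of p] by simp

lemma penultimate_cases: "m = Suc p \<Longrightarrow> x \<in> L p \<Longrightarrow> x \<in> L m \<or> x \<in> level p"
  by simp

lemma corner_rank_eq: "corner_rank V E = Suc m"
proof -
  have "(LEAST k. is_clique E (L k)) = m"
    by (rule Least_equality) (use clique_top not_clique in \<open>auto intro: leI\<close>)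
  then show ?thesis by (simp add: corner_rank_def)
qed

lemma type1_iff:
  assumes "m = Suc p"
  shows "type1 V E \<longleftrightarrow> (\<exists>v\<in>L m. dominates E v (L p))"
proof -
  have "rank_set V E (corner_rank V E) = L m"
    using level_top by (simp add: rank_set_def corner_rank_eq)
  moreover have "corner_rank V E - 2 = p" by (simp add: corner_rank_eq assms)
  ultimately show ?thesis by (simp only: type1_def)
qed

text \<open>A top vertex missing something in \<open>L p\<close> would be strictly cornered there by
  the dominating vertex, and so would not survive into \<open>L m\<close>.\<close>

lemma type1_all:
  assumes "m = Suc p" "type1 V E" "u \<in> L m"
  shows "dominates E u (L p)"
proof (rule ccontr)
  assume "\<not> ?thesis"
  then obtain x where x: "x \<in> L p" "\<not> E u x" unfolding dominates_def by blast
  obtain v where v: "v \<in> L m" "dominates E v (L p)" using assms(2) type1_iff[OF assms(1)] by blast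
  have "nbhd E (L p) u \<subset> nbhd E (L p) v"
  proof
    show "nbhd E (L p) u \<subseteq> nbhd E (L p) v"
      using v(2) unfolding dominates_def by (simp add: subset_iff mem_nbhd)
    have "x \<in> nbhd E (L p) v" "x \<notin> nbhd E (L p) u"
      using v(2) x by (simp_all add: dominates_def mem_nbhd)
    then show "nbhd E (L p) u \<noteq> nbhd E (L p) v" by blast
  qed
  moreover have uv: "u \<in> L p" "v \<in> L p" using assms(1,3) v(1) layer_step[of p] by blast+
  ultimately have "u \<in> strict_corners E (L p)" by (intro strict_cornersI[OF uv])
  moreover have "L m = L p - strict_corners E (L p)" using assms(1) layer_Suc_eq[of p] by simp
  ultimately show False using assms(3) by blast
qed

text \<open>If \<open>h\<close> were alone, a top vertex cornering it would dominate
  \<open>L p\<close>. By \<open>type1_all\<close> every top vertex would see \<open>h\<close>, so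
  \<open>h\<close> itself would dominate, which a strict corner cannot.\<close>

lemma card_penultimate_level:
  assumes "m = Suc p" shows "2 \<le> card (level p)"
proof (rule two_le_card)
  show "card (level p) \<noteq> 1"
  proof
    assume "card (level p) = 1"
    then obtain h where h: "level p = {h}" using card_1_singletonE by blast
    have Lp: "L p = insert h (L m)" using penultimate_layer[OF assms] h by simp
    obtain c where c: "c \<in> L m" "E c h" using cornerer_exists[of p h] assms h by auto
    have "dominates E c (L p)"
      unfolding dominates_def Lp using c top_adj by blast
    then have "type1 V E" using type1_iff[OF assms] c(1) by auto
    then have "E u h" if "u \<in> L m" for u
      using type1_all[OF assms _ that] Lp unfolding dominates_def by simp
    then have "E h u" if "u \<in> L m" for u using that adj_sym by simp
    moreover have "E h h" using Lp in_layer_refl[of h p] by simp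
    ultimately show False
      using level_nonneighbour[of p h] h assms Lp by auto
  qed
qed (use assms in simp)

text \<open>The vertex \<open>z\<close> from \<open>level_single\<close> sees all of
  \<open>level (Suc p)\<close>. If \<open>z\<close> is in the top clique, it dominates and thus
  corners that level, contrary to its choice. Otherwise a vertex cornering \<open>z\<close>
  dominates, and \<open>type1_all\<close> makes the strict corner \<open>z\<close> dominate
  too.\<close>

lemma card_third_level:
  assumes "m = Suc (Suc p)" shows "2 \<le> card (level p)"
proof (rule two_le_card)
  have lt: "Suc p < m" using assms by simp
  note top = top_adj and Lp = penultimate_cases[OF assms]
  have dom: "dominates E u (L (Suc p))"
    if "u \<in> L m" "\<And>h. h \<in> level (Suc p) \<Longrightarrow> E u h" for u
    unfolding dominates_def using that top Lp by blast
  show "card (level p) \<noteq> 1"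
  proof
    assume "card (level p) = 1"
    then obtain z where z: "z \<in> L (Suc p)"
      "\<And>h. h \<in> level (Suc p) \<Longrightarrow> E z h \<and> \<not> corners (Suc p) z h"
      using level_single[of p] lt by blast
    obtain h where h: "h \<in> level (Suc p)" using level_nonempty[of "Suc p"] lt by auto
    show False
    proof (cases "z \<in> L m")
      case True
      then have "dominates E z (L (Suc p))" using dom z(2) by blast
      then show False using dominates_corners[OF lt h] z(2)[OF h] by blast
    next
      case False
      then have zl: "z \<in> level (Suc p)" using z(1) Lp by blast
      then obtain c where c: "c \<in> L m" "\<forall>x\<in>L (Suc p). E z x \<longrightarrow> E c x"
        using cornerer_exists[OF lt zl] assms by auto
      have "E c h" if "h \<in> level (Suc p)" for h using c(2) z(2)[OF that] that by blast
      then have "dominates E c (L (Suc p))" using dom c(1) by blast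
      then have "type1 V E" using type1_iff[OF assms] c(1) by auto
      then have "E u z" if "u \<in> L m" for u
        using type1_all[OF assms _ that] z(1) unfolding dominates_def by blast
      then have zu: "E z u" if "u \<in> L m" for u using that adj_sym by blast
      obtain x where "x \<in> L (Suc p)" "\<not> E z x" using level_nonneighbour[OF lt zl] by blast
      then show False using zu z(2)[of x] Lp by blast
    qed
  qed
qed (use assms in simp)

lemma single_top:
  assumes "m = Suc p" "L m = {v}" "h \<in> level p"
  shows "corners p v h" "E v h"
  using cornerer_exists[of p h] assms by auto

lemma single_top_two:
  assumes "m = Suc p" "L m = {v}" "card (level p) = 2"
  shows "two_pendants p"
proof -
  obtain g h where gh: "level p = {g, h}" "g \<noteq> h" using assms(3) card_2_iff by metis
  have Lp: "L p = {v, g, h}" using layer_eq_level[of p] assms gh by blast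
  have v: "v \<notin> {g, h}" "E v g" "E v h"
    using gh assms single_top[OF assms(1,2)] by blast+
  have refl: "E g g" "E h h" using in_layer_refl[of _ p] Lp by blast+
  have "\<not> E g h"
    using level_nonneighbour[of p g] assms(1) gh Lp v refl adj_sym by auto
  then have "pendant p g v" "pendant p h v"
    using gh v Lp adj_sym by (auto intro!: pendantI)
  with \<open>\<not> E g h\<close> show ?thesis unfolding two_pendants_def by blast
qed

text \<open>All three vertices see \<open>v\<close>, so each misses another one of the three. Three
  points cannot be covered by a single non-edge, so some vertex misses both others and is pendant at
  \<open>v\<close>.\<close>

lemma single_top_three:
  assumes "m = Suc p" "L m = {v}" "card (level p) = 3"
  shows "\<exists>a b c. pendant_apart p a b c"
proof -
  obtain f g h where fgh: "level p = {f, g, h}"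
    using assms(3) card_3_iff by metis
  have v: "v \<in> L p" "v \<notin> level p" using assms(1,2) layer_step[of p] by auto
  have isolated: ?thesis if abc: "level p = {a, b, c}" "\<not> E b a" "\<not> E b c" for a b c
  proof -
    have ab: "a \<in> level p" "b \<in> level p" unfolding abc(1) by simp_all
    have "pendant p b v"
    proof (rule pendantI)
      show "v \<noteq> b" using v(2) ab(2) by blast
      show "E b v" using single_top(2)[OF assms(1,2) ab(2)] adj_sym by blast
      fix x assume x: "x \<in> L p" "E b x"
      then have "x = v \<or> x \<in> {a, b, c}"
        using penultimate_cases[OF assms(1) x(1)] assms(2) abc(1) by simp
      then show "x = b \<or> x = v" using abc(2,3) x(2) by auto
    qed (use v ab in simp_all)
    moreover have "corners p v a" by (rule single_top(1)[OF assms(1,2) ab(1)])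
    moreover have "\<not> E a b" using abc(2) adj_sym by blast
    ultimately have "pendant_apart p a b v" using ab(1) unfolding pendant_apart_def by simp
    then show ?thesis by blast
  qed
  have nonadj: "\<exists>y\<in>{f, g, h}. \<not> E x y \<and> y \<noteq> x" if "x \<in> {f, g, h}" for x
  proof -
    have x: "x \<in> level p" using that fgh by simp
    then have "E x v" using single_top(2)[OF assms(1,2)] adj_sym by blast
    moreover obtain y where y: "y \<in> L p" "\<not> E x y" using level_nonneighbour[OF _ x] assms(1) by auto
    ultimately have "y \<in> {f, g, h}"
      using penultimate_cases[OF assms(1) y(1)] assms(2) fgh by auto
    moreover have "E x x" using x in_layer_refl[of x p] by blast
    ultimately show ?thesis using y(2) by blast
  qed
  then have "\<not> E f g \<or> \<not> E f h" "\<not> E g f \<or> \<not> E g h" "\<not> E h f \<or> \<not> E h g" by auto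
  then consider "\<not> E f g" "\<not> E f h" | "\<not> E g f" "\<not> E g h" | "\<not> E h f" "\<not> E h g"
    using adj_sym by blast
  then show ?thesis
  proof cases
    case 1
    then show ?thesis using isolated[of g f h] fgh by (simp add: insert_commute)
  next
    case 2
    then show ?thesis using isolated[of f g h] fgh by simp
  next
    case 3
    then show ?thesis using isolated[of f h g] fgh by (simp add: insert_commute)
  qed
qed

section \<open>Type 0 with few vertices in the top two levels\<close>

lemma top_nonneighbour:
  assumes "m = Suc p" "\<not> type1 V E" "k \<in> L m"
  shows "\<exists>h\<in>level p. \<not> E k h"
proof -
  obtain x where "x \<in> L p" "\<not> E k x"
    using assms type1_iff[OF assms(1)] unfolding dominates_def by blast
  then show ?thesis
    using penultimate_cases[OF assms(1)] top_adj[OF assms(3)] by blast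
qed

lemma type0_card_top:
  assumes "m = Suc p" "\<not> type1 V E"
  shows "2 \<le> card (level m)"
proof (rule two_le_card)
  show "card (level m) \<noteq> 1"
  proof
    assume "card (level m) = 1"
    then obtain v where "L m = {v}" using level_top card_1_singletonE by metis
    then show False using top_nonneighbour[OF assms] single_top[OF assms(1)] by blast
  qed
qed simp

text \<open>A top vertex seeing both \<open>g\<close> and \<open>h\<close> would dominate; in
  particular a top vertex cornering \<open>g\<close> rules out an edge between \<open>g\<close> and
  \<open>h\<close>. A top vertex seeing neither would be strictly cornered by a top vertex that sees
  \<open>g\<close>.\<close>

lemma type0_two:
  assumes "m = Suc p" "\<not> type1 V E" "level p = {g, h}"
  shows "\<not> E g h" "\<And>k. k \<in> L m \<Longrightarrow> E k g \<longleftrightarrow> \<not> E k h"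
    "\<exists>k\<in>L m. corners p k g" "\<exists>k\<in>L m. corners p k h"
proof -
  have gh: "g \<in> level p" "h \<in> level p" unfolding assms(3) by simp_all
  obtain a where a: "a \<in> L m" "corners p a g" "E a g" "\<forall>x\<in>L p. E g x \<longrightarrow> E a x"
    using cornerer_exists[of p g] assms(1) gh by auto
  obtain b where b: "b \<in> L m" "corners p b h" "E b h" "\<forall>x\<in>L p. E h x \<longrightarrow> E b x"
    using cornerer_exists[of p h] assms(1) gh by auto
  have miss: "\<not> E k g \<or> \<not> E k h" if "k \<in> L m" for k
    using top_nonneighbour[OF assms(1,2) that] unfolding assms(3) by blast
  show "\<not> E g h" using miss[OF a(1)] a gh by blast
  show "E k g \<longleftrightarrow> \<not> E k h" if k: "k \<in> L m" for k
  proof (rule ccontr)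
    assume "(E k g) \<noteq> (\<not> E k h)"
    then have n: "\<not> E k g" "\<not> E k h" using miss[OF k] by blast+
    have ak: "a \<in> L p" "k \<in> L p" using a(1) k assms(1) layer_step[of p] by auto
    have "nbhd E (L p) k \<subset> nbhd E (L p) a"
    proof
      show "nbhd E (L p) k \<subseteq> nbhd E (L p) a"
      proof
        fix x assume "x \<in> nbhd E (L p) k"
        then have x: "x \<in> L p" "E k x" by (simp_all add: mem_nbhd)
        moreover have "x \<noteq> g" "x \<noteq> h" using x(2) n by blast+
        ultimately have "x \<in> L m" using penultimate_cases[OF assms(1) x(1)] assms(3) by simp
        then show "x \<in> nbhd E (L p) a" using x(1) top_adj[OF a(1)] by (simp add: mem_nbhd)
      qed
      show "nbhd E (L p) k \<noteq> nbhd E (L p) a"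
        using n(1) a(3) gh(1) mem_nbhd[of g E "L p"] by blast
    qed
    then have "k \<in> strict_corners E (L p)" by (rule strict_cornersI[OF ak(2,1)])
    moreover have "L m = L p - strict_corners E (L p)" using assms(1) layer_Suc_eq[of p] by simp
    ultimately show False using k by blast
  qed
  show "\<exists>k\<in>L m. corners p k g" "\<exists>k\<in>L m. corners p k h" using a b by blast+
qed

lemma type0_two_pendant:
  assumes "m = Suc p" "\<not> type1 V E" "level p = {g, h}"
    "k \<in> L m" "E k h" "\<And>l. l \<in> L m \<Longrightarrow> l \<noteq> k \<Longrightarrow> E l g"
  shows "pendant p h k"
proof (rule pendantI)
  show h: "h \<in> level p" unfolding assms(3) by simp
  show "E h k" by (rule adj_sym[OF assms(5)])
  show "k \<in> L p" using assms(1,4) layer_step[of p] by auto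
  show "k \<noteq> h" using assms(1,4) h by auto
  show "x = h \<or> x = k" if x: "x \<in> L p" "E h x" for x
  proof (cases "x \<in> L m")
    case True
    then show ?thesis using type0_two(2)[OF assms(1-3) True] assms(6)[OF True] adj_sym[OF x(2)] by blast
  next
    case False
    then have "x = g \<or> x = h" using penultimate_cases[OF assms(1) x(1)] assms(3) by simp
    then show ?thesis using type0_two(1)[OF assms(1-3)] adj_sym[OF x(2)] by blast
  qed
qed

lemma type0_two_two:
  assumes "m = Suc p" "\<not> type1 V E" "card (level m) = 2" "card (level p) = 2"
  shows "two_pendants p"
proof -
  obtain g h where gh: "level p = {g, h}" using assms(4) card_2_iff by metis
  then have hg: "level p = {h, g}" by blast
  note t = type0_two[OF assms(1,2) gh]
  have ghL: "g \<in> L p" "h \<in> L p" using gh by blast+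
  obtain a b where ab: "a \<in> L m" "b \<in> L m" "E a g" "E b h"
    using t(3,4) cornersD(1)[of p] ghL by blast
  then have "a \<noteq> b" using t(2) by blast
  then have "L m = {a, b}"
    using card_subset_eq[OF finite_layer, of "{a, b}" m] ab assms(3) level_top by simp
  then have "\<And>l. l \<in> L m \<Longrightarrow> l \<noteq> b \<Longrightarrow> E l g" "\<And>l. l \<in> L m \<Longrightarrow> l \<noteq> a \<Longrightarrow> E l h"
    using ab by auto
  then have "pendant p h b" "pendant p g a"
    using type0_two_pendant[OF assms(1,2) gh ab(2,4)] type0_two_pendant[OF assms(1,2) hg ab(1,3)]
    by blast+
  with t(1) show ?thesis unfolding two_pendants_def by blast
qed

text \<open>Each of the three top vertices sees exactly one of \<open>g\<close> and
  \<open>h\<close>, so one of these two has just one top neighbor and is pendant.\<close>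

lemma type0_three_two:
  assumes "m = Suc p" "\<not> type1 V E" "card (level m) = 3" "card (level p) = 2"
  shows "\<exists>a b c. pendant_apart p a b c"
proof -
  obtain g h where gh: "level p = {g, h}" using assms(4) card_2_iff by metis
  then have hg: "level p = {h, g}" by blast
  note t = type0_two[OF assms(1,2) gh]
  have ghL: "g \<in> L p" "h \<in> L p" using gh by blast+
  obtain a b where ab: "a \<in> L m" "b \<in> L m" "E a g" "E b h"
    using t(3,4) cornersD(1)[of p] ghL by blast
  then have "a \<noteq> b" using t(2) by blast
  then have "card (L m - {a, b}) = 1"
    using ab assms(3) level_top by (simp add: card_Diff_subset)
  then obtain c where "L m - {a, b} = {c}" using card_1_singletonE by blast
  then have c: "L m = {a, b, c}" using ab by blast
  show ?thesis
  proof (cases "E c g")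
    case True
    then have "E l g" if "l \<in> L m" "l \<noteq> b" for l using that ab c by auto
    then have "pendant p h b" by (rule type0_two_pendant[OF assms(1,2) gh ab(2,4)])
    then have "pendant_apart p g h b"
      using t(1) t(2)[OF ab(2)] ab(4) gh adj_sym unfolding pendant_apart_def by blast
    then show ?thesis by blast
  next
    case False
    then have "E c h" using t(2)[of c] c by blast
    then have "E l h" if "l \<in> L m" "l \<noteq> a" for l using that ab c by auto
    then have "pendant p g a" by (rule type0_two_pendant[OF assms(1,2) hg ab(1,3)])
    then have "pendant_apart p h g a"
      using t(1) t(2)[OF ab(1)] ab(3) gh adj_sym unfolding pendant_apart_def by blast
    then show ?thesis by blast
  qed
qed

text \<open>The vertices \<open>g\<close> and \<open>h\<close> have private neighbors
  \<open>u\<close> and \<open>v\<close> below, which exhaust the next level. Then \<open>v\<close>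
  is a tip at \<open>h\<close> while \<open>u\<close> misses \<open>h\<close>, and
  \<open>tip_card_below\<close> applies.\<close>

lemma type0_two_below:
  assumes "m = Suc (Suc (Suc p))" "\<not> type1 V E"
    "card (level (Suc (Suc p))) = 2" "card (level (Suc p)) = 2"
  shows "2 \<le> card (level p)"
proof -
  have lt: "Suc p < m" using assms(1) by simp
  obtain g h where gh: "level (Suc (Suc p)) = {g, h}" "g \<noteq> h" using assms(3) card_2_iff by metis
  note t = type0_two[OF assms(1,2) gh(1)]
  let ?P = "L (Suc (Suc p))"
  have ghL: "g \<in> ?P" "h \<in> ?P" using gh by blast+
  have P: "x \<in> L m \<or> x = g \<or> x = h" if "x \<in> ?P" for x
    using penultimate_cases[OF assms(1) that] gh(1) by simp
  obtain a b where ab: "a \<in> L m" "b \<in> L m" "corners (Suc (Suc p)) a g" "corners (Suc (Suc p)) b h"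
    using t(3,4) by blast
  have mP: "L m \<subseteq> ?P" using assms(1) layer_step[of "Suc (Suc p)"] by simp
  have witness: "\<exists>w\<in>level (Suc p). E x w \<and> \<not> E c w"
    if "x \<in> ?P" "c \<in> L m" "corners (Suc (Suc p)) c x" for x c
    using corner_witness[OF lt that(1)] that mP by blast
  obtain u v where u: "u \<in> level (Suc p)" "E g u" and v: "v \<in> level (Suc p)" "E h v"
    using witness[OF ghL(1) ab(1,3)] witness[OF ghL(2) ab(2,4)] by blast
  have apart: "\<not> (E g x \<and> E h x)" if x: "x \<in> level (Suc p)" for x
  proof
    assume gx: "E g x \<and> E h x"
    obtain y where y: "y \<in> ?P" "\<forall>z\<in>L (Suc p). E x z \<longrightarrow> E y z"
      using cornerer_exists[OF lt x] by blast
    have "g \<in> L (Suc p)" "h \<in> L (Suc p)" using ghL layer_step[of "Suc p"] by blast+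
    then have "E y g" "E y h" using y(2) gx adj_sym by blast+
    then show False using P[OF y(1)] t(1) t(2)[of y] adj_sym by blast
  qed
  have "u \<noteq> v" using apart u v by blast
  then have U: "level (Suc p) = {u, v}"
    using card_subset_eq[OF finite_level, of "{u, v}" "Suc p"] u v assms(4) by simp
  have hu: "\<not> E h u" using apart u by blast
  \<comment> \<open>Each top vertex \<open>k\<close> that sees \<open>h\<close> corners it, so
    \<open>k\<close> misses some neighbor of \<open>h\<close> in the level below; only
    \<open>v\<close> qualifies.\<close>
  have vk: "\<not> E k v" if k: "k \<in> L m" "E k h" for k
  proof -
    have "corners (Suc (Suc p)) k h"
    proof
      show "nbhd E ?P h \<subseteq> nbhd E ?P k"
      proof
        fix x assume "x \<in> nbhd E ?P h"
        then have x: "x \<in> ?P" "E h x" by (simp_all add: mem_nbhd)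
        then have "x \<in> L m \<or> x = h" using P t(1) adj_sym by blast
        then have "E k x" using k top_adj by blast
        then show "x \<in> nbhd E ?P k" using x by (simp add: mem_nbhd)
      qed
      have "E k a" using k(1) ab(1) by (rule top_adj)
      moreover have "\<not> E h a"
        using t(2)[OF ab(1)] cornersD(1)[OF ab(3) ghL(1)] adj_sym by blast
      ultimately show "nbhd E ?P h \<noteq> nbhd E ?P k"
        using ab(1) mP mem_nbhd[of a E ?P] by blast
    qed
    then obtain w where "w \<in> level (Suc p)" "E h w" "\<not> E k w"
      using witness[OF ghL(2) k(1)] by blast
    moreover from this have "w = v" using U hu by auto
    ultimately show ?thesis by blast
  qed
  obtain y where y: "y \<in> ?P" "E y v" "\<forall>z\<in>L (Suc p). E v z \<longrightarrow> E y z"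
    using cornerer_exists[OF lt v(1)] by blast
  have "E y h" using y(3) v(2) ghL layer_step[of "Suc p"] adj_sym by blast
  then have "y = h" using P[OF y(1)] vk[of y] y(2) t(1) by blast
  have "nbhd E ?P v = {h}"
  proof (intro equalityI subsetI)
    fix x assume "x \<in> nbhd E ?P v"
    then have x: "x \<in> ?P" "E v x" by (simp_all add: mem_nbhd)
    then have "E h x" using y(3) \<open>y = h\<close> layer_step[of "Suc p"] by blast
    then show "x \<in> {h}" using P[OF x(1)] vk[of x] x(2) t(1) adj_sym by blast
  next
    fix x assume "x \<in> {h}"
    then show "x \<in> nbhd E ?P v" using ghL v(2) adj_sym by (simp add: mem_nbhd)
  qed
  then have "tip (Suc p) v h" using v(1) unfolding tip_def by blast
  then show ?thesis using tip_card_below[OF lt _ u(1)] hu by blast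
qed

lemma type0_edge:
  assumes "m = Suc p" "\<not> type1 V E" "L m = {a, b}"
  shows "\<exists>s\<in>level p. E a s \<and> \<not> E b s" "h \<in> level p \<Longrightarrow> corners p a h \<or> corners p b h"
proof -
  show cor: "corners p a h \<or> corners p b h" if "h \<in> level p" for h
    using cornerer_exists[of p h] assms that by auto
  have "b \<in> L m" unfolding assms(3) by simp
  then obtain s where s: "s \<in> level p" "\<not> E b s" using top_nonneighbour[OF assms(1,2)] by blast
  then have "E a s" using cor[OF s(1)] cornersD(1)[of p s a] cornersD(1)[of p s b] s by blast
  with s show "\<exists>s\<in>level p. E a s \<and> \<not> E b s" by blast
qed

text \<open>Let \<open>s\<close> and \<open>t\<close> be private neighbors of \<open>a\<close> and
  \<open>b\<close>. A vertex cornered by \<open>a\<close> misses \<open>t\<close>, one cornered by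
  \<open>b\<close> misses \<open>s\<close>; hence the third vertex \<open>u\<close> leaves one of
  \<open>s\<close> and \<open>t\<close> pendant.\<close>

lemma type0_two_three:
  assumes "m = Suc p" "\<not> type1 V E" "card (level m) = 2" "card (level p) = 3"
  shows "\<exists>a b c. pendant_apart p a b c"
proof -
  obtain a b where ab: "L m = {a, b}" using assms(3) level_top card_2_iff by metis
  then have ba: "L m = {b, a}" by blast
  note cor = type0_edge(2)[OF assms(1,2) ab]
  obtain s where s: "s \<in> level p" "E a s" "\<not> E b s" using type0_edge(1)[OF assms(1,2) ab] by blast
  obtain t where t: "t \<in> level p" "E b t" "\<not> E a t" using type0_edge(1)[OF assms(1,2) ba] by blast
  have stL: "s \<in> L p" "t \<in> L p" using s t by blast+
  have apart: "\<not> (E h s \<and> E h t)" if h: "h \<in> level p" for h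
    using cor[OF h] cornersD(2)[of p h a t] cornersD(2)[of p h b s] h stL s(3) t(3) by blast
  have st: "\<not> E s t" "s \<noteq> t"
    using apart[OF s(1)] in_layer_refl[OF stL(1)] s t by blast+
  then have "card (level p - {s, t}) = 1" using s(1) t(1) assms(4) by (simp add: card_Diff_subset)
  then obtain u where "level p - {s, t} = {u}" using card_1_singletonE by blast
  then have u: "level p = {s, t, u}" using s(1) t(1) by blast
  have Lp: "x = a \<or> x = b \<or> x = s \<or> x = t \<or> x = u" if "x \<in> L p" for x
    using penultimate_cases[OF assms(1) that] ab u by simp
  have abL: "a \<in> L p" "b \<in> L p" "a \<notin> level p" "b \<notin> level p"
    using ab assms(1) layer_step[of p] by auto
  from apart[of u] have "\<not> (E u s \<and> E u t)" unfolding u by simp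
  then consider "\<not> E t u" | "\<not> E s u" using adj_sym by blast
  then show ?thesis
  proof cases
    case 1
    have "pendant p t b"
    proof (rule pendantI)
      show "b \<noteq> t" using t(1) abL by blast
      show "x = t \<or> x = b" if "x \<in> L p" "E t x" for x
        using Lp[OF that(1)] that(2) 1 t(3) st(1) adj_sym by blast
    qed (use t abL adj_sym in simp_all)
    then have "pendant_apart p s t b"
      using s st(1) adj_sym unfolding pendant_apart_def by blast
    then show ?thesis by blast
  next
    case 2
    have "pendant p s a"
    proof (rule pendantI)
      show "a \<noteq> s" using s(1) abL by blast
      show "x = s \<or> x = a" if "x \<in> L p" "E s x" for x
        using Lp[OF that(1)] that(2) 2 s(3) st(1) adj_sym by blast
    qed (use s abL adj_sym in simp_all)
    then have "pendant_apart p t s a"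
      using t st(1) adj_sym unfolding pendant_apart_def by blast
    then show ?thesis by blast
  qed
qed

text \<open>Excludes a vertex \<open>c\<close> seeing \<open>a\<close>, \<open>b\<close>,
  \<open>u\<close> and \<open>v\<close> when \<open>a\<close> corners it. The other hypotheses are
  symmetric under exchanging the two sides, so the case where \<open>b\<close> corners
  \<open>c\<close> follows as well.\<close>

lemma type0_two_four_aux:
  assumes k: "Suc k < m" and P: "\<And>x. x \<in> L (Suc k) \<Longrightarrow> x = a \<or> x = b \<or> x \<in> level (Suc k)"
    and card4: "card (level (Suc k)) = 4"
    and H: "s \<in> level (Suc k)" "t \<in> level (Suc k)" "c \<in> level (Suc k)"
    and U: "u \<in> level k" "v \<in> level k"
    and adj: "E a s" "E b t" "E s u" "E t v" "E a c" "E b c" "E c u" "E c v"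
    and nadj: "\<not> E b s" "\<not> E a t" "\<not> E a u" "\<not> E b v"
    and cor: "\<And>h. h \<in> level (Suc k) \<Longrightarrow> corners (Suc k) a h \<or> corners (Suc k) b h"
    and c: "corners (Suc k) a c"
  shows False
proof -
  let ?P = "L (Suc k)"
  have lt: "k < m" using k by simp
  have dom: "E d x \<or> \<not> E h x" if "corners (Suc k) d h" "x \<in> ?P" for d h x
    using mem_nbhd[of x E ?P] that by blast
  have HP: "s \<in> ?P" "t \<in> ?P" "c \<in> ?P" using H by blast+
  have sk: "s \<in> L k" "t \<in> L k" "c \<in> L k" using HP layer_step[of k] by blast+
  have ct: "\<not> E c t" using dom[OF c HP(2)] nadj by blast
  have sa: "corners (Suc k) a s" using cor[OF H(1)] dom[of s b s] HP(1) in_layer_refl[OF HP(1)] nadj(1) by metis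
  have st: "\<not> E s t" using dom[OF sa HP(2)] nadj by blast
  \<comment> \<open>This \<open>y\<close> is the fourth vertex of the level besides
    \<open>s\<close>, \<open>t\<close> and \<open>c\<close>; seeing \<open>t\<close>, it is cornered
    by \<open>b\<close> and so misses \<open>s\<close>.\<close>
  obtain y where y: "y \<in> ?P" "E y v" "\<forall>x\<in>L k. E v x \<longrightarrow> E y x"
    using cornerer_exists[OF lt U(2)] by blast
  have yt: "E y t" "E y c" using y(3) sk adj adj_sym by blast+
  have yH: "y \<in> level (Suc k)" using P[OF y(1)] yt(1) nadj(2) y(2) nadj(4) by blast
  have yb: "corners (Suc k) b y" using cor[OF yH] dom[of y a t] HP(2) yt(1) nadj(2) by metis
  have ys: "\<not> E y s" using dom[OF yb HP(1)] nadj(1) by blast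
  have "s \<noteq> t" "s \<noteq> c" "s \<noteq> y" "t \<noteq> c" "t \<noteq> y" "c \<noteq> y"
    using st ct yt(1) adj_sym[OF yt(2)] adj(6) nadj(1) in_layer_refl[OF HP(2)] by blast+
  then have "card {s, t, c, y} = 4" by simp
  then have "level (Suc k) = {s, t, c, y}"
    using card_subset_eq[OF finite_level, of "{s, t, c, y}" "Suc k"] H yH card4 by simp
  then have P': "w = a \<or> w = b \<or> w = s \<or> w = t \<or> w = c \<or> w = y" if "w \<in> ?P" for w
    using P[OF that] by auto
  obtain x where x: "x \<in> ?P" "E a x" "\<not> E c x"
    using c unfolding psubset_eq by (auto simp: nbhd_def)
  have "E c c" by (rule in_layer_refl[OF HP(3)])
  then have "x = s" using x(2,3) P'[OF x(1)] nadj(2) adj(5,6) yt(2) adj_sym by blast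
  then have cs: "\<not> E c s" using x by blast
  \<comment> \<open>A vertex cornering \<open>u\<close> sees \<open>s\<close>, \<open>c\<close> and
    \<open>u\<close>, but none of the six vertices of \<open>?P\<close> sees all three.\<close>
  obtain w where w: "w \<in> ?P" "E w u" "\<forall>x\<in>L k. E u x \<longrightarrow> E w x"
    using cornerer_exists[OF lt U(1)] by blast
  have "E w s" "E w c" using w(3) sk adj adj_sym by blast+
  then show False using w(2) P'[OF w(1)] nadj cs st ys adj_sym by blast
qed

text \<open>A single vertex in \<open>level p\<close> would yield a vertex of \<open>?P\<close>
  seeing both \<open>u\<close> and \<open>v\<close>. It lies in \<open>?H\<close> and sees
  \<open>a\<close> and \<open>b\<close>, which \<open>type0_two_four_aux\<close> excludes.\<close>

lemma type0_two_four_below: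
  assumes "m = Suc (Suc (Suc p))" "\<not> type1 V E" "card (level m) = 2"
    "card (level (Suc (Suc p))) = 4" "card (level (Suc p)) = 2"
  shows "2 \<le> card (level p)"
proof (rule two_le_card)
  have lt: "Suc (Suc p) < m" "Suc p < m" "p < m" using assms(1) by simp_all
  let ?P = "L (Suc (Suc p))" and ?H = "level (Suc (Suc p))"
  obtain a b where ab: "L m = {a, b}" using assms(3) level_top card_2_iff by metis
  then have ba: "L m = {b, a}" by blast
  note cor = type0_edge(2)[OF assms(1,2) ab]
  obtain s where s: "s \<in> ?H" "E a s" "\<not> E b s" using type0_edge(1)[OF assms(1,2) ab] by blast
  obtain t where t: "t \<in> ?H" "E b t" "\<not> E a t" using type0_edge(1)[OF assms(1,2) ba] by blast
  have P: "x = a \<or> x = b \<or> x \<in> ?H" if "x \<in> ?P" for x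
    using penultimate_cases[OF assms(1) that] unfolding ab by simp
  have HP: "s \<in> ?P" "t \<in> ?P" "a \<in> ?P" "b \<in> ?P"
    using s(1) t(1) ab assms(1) layer_step[of "Suc (Suc p)"] by auto
  have apart: "\<not> (E h x \<and> E h y)"
    if "h \<in> ?H" "x \<in> ?P" "y \<in> ?P" "\<not> E a y" "\<not> E b x" for h x y
    using cor[OF that(1)] cornersD(2)[of "Suc (Suc p)" h a y]
      cornersD(2)[of "Suc (Suc p)" h b x] that by blast
  have "corners (Suc (Suc p)) a s" "corners (Suc (Suc p)) b t"
    using cor[OF s(1)] cor[OF t(1)] cornersD(1)[OF _ HP(1), of b] cornersD(1)[OF _ HP(2), of a]
      s(3) t(3) by blast+
  then obtain u v where u: "u \<in> level (Suc p)" "E s u" "\<not> E a u"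
    and v: "v \<in> level (Suc p)" "E t v" "\<not> E b v"
    using corner_witness[OF lt(2) HP(1,3)] corner_witness[OF lt(2) HP(2,4)] by blast
  \<comment> \<open>A vertex cornering \<open>w\<close> would see both \<open>x\<close> and
    \<open>y\<close>. But \<open>a\<close> misses \<open>y\<close>, \<open>b\<close> misses
    \<open>x\<close>, and every vertex of \<open>?H\<close> is cornered by one of them.\<close>
  have sep: "\<not> (E w x \<and> E w y)"
    if w: "w \<in> level (Suc p)" and x: "x \<in> ?H" "\<not> E b x" and y: "y \<in> ?H" "\<not> E a y" for w x y
  proof
    assume wxy: "E w x \<and> E w y"
    obtain d where d: "d \<in> ?P" "\<forall>x\<in>L (Suc p). E w x \<longrightarrow> E d x"
      using cornerer_exists[OF lt(2) w] by blast
    have "x \<in> L (Suc p)" "y \<in> L (Suc p)" "x \<in> ?P" "y \<in> ?P" using x y layer_step[of "Suc p"] by blast+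
    then have "E d x" "E d y" using d(2) wxy by blast+
    then show False
      using apart[of d x y] P[OF d(1)] x y \<open>x \<in> ?P\<close> \<open>y \<in> ?P\<close> by blast
  qed
  have "u \<noteq> v" using sep[OF u(1) s(1,3) t(1,3)] u v adj_sym by blast
  then have U: "level (Suc p) = {u, v}"
    using card_subset_eq[OF finite_level, of "{u, v}" "Suc p"] u v assms(5) by simp
  have middle: "d \<in> ?H \<and> E a d \<and> E b d" if d: "d \<in> ?P" "E d u" "E d v" for d
  proof -
    have dH: "d \<in> ?H" using d(2,3) P[OF d(1)] u(3) v(3) by blast
    moreover have "E a d"
    proof (rule ccontr)
      assume "\<not> E a d"
      then show False using sep[OF u(1) s(1,3) dH] d(2) u(2) adj_sym by blast
    qed
    moreover have "E b d"
    proof (rule ccontr)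
      assume "\<not> E b d"
      then show False using sep[OF v(1) dH _ t(1,3)] d(3) v(2) adj_sym by blast
    qed
    ultimately show ?thesis by blast
  qed
  show "card (level p) \<noteq> 1"
  proof
    assume "card (level p) = 1"
    then obtain z where z: "z \<in> L (Suc p)" "E z u" "E z v"
      using level_single[OF lt(2)] u(1) v(1) by blast
    have "\<exists>c\<in>?P. E c u \<and> E c v"
    proof (cases "z \<in> ?P")
      case False
      then have zl: "z \<in> level (Suc p)" using z(1) by blast
      then have "u \<in> L (Suc p)" "v \<in> L (Suc p)" using u v by blast+
      then show ?thesis using cornerer_exists[OF lt(2) zl] z by blast
    qed (use z in blast)
    then obtain c where c: "c \<in> ?P" "E c u" "E c v" by blast
    note c' = middle[OF c]
    have P': "x = b \<or> x = a \<or> x \<in> ?H" if "x \<in> ?P" for x using P[OF that] by blast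
    from cor[of c] c' consider "corners (Suc (Suc p)) a c" | "corners (Suc (Suc p)) b c" by blast
    then show False
    proof cases
      case 1
      show False
        by (rule type0_two_four_aux[OF lt(1) P assms(4) s(1) t(1) _ u(1) v(1) s(2) t(2) u(2) v(2)
              _ _ c(2,3) s(3) t(3) u(3) v(3) cor 1]) (use c' in blast)+
    next
      case 2
      have cor': "corners (Suc (Suc p)) b h \<or> corners (Suc (Suc p)) a h" if "h \<in> ?H" for h
        using cor[OF that] by blast
      show False
        by (rule type0_two_four_aux[OF lt(1) P' assms(4) t(1) s(1) _ v(1) u(1) t(2) s(2) v(2) u(2)
              _ _ c(3,2) t(3) s(3) v(3) u(3) cor' 2]) (use c' in blast)+
    qed
  qed
qed (use assms(1) in simp)

section \<open>Lower bounds for the top levels by counting vertices\<close>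

lemma type1_levels:
  assumes "m = Suc (Suc (Suc (Suc (Suc q))))" "type1 V E" "card V = q + 10" "card (level m) = 1"
  shows "4 \<le> card (level (Suc (Suc (Suc (Suc q)))))"
proof (rule ccontr)
  let ?p = "Suc (Suc (Suc (Suc q)))"
  assume "\<not> 4 \<le> card (level ?p)"
  then consider "card (level ?p) = 2" | "card (level ?p) = 3"
    using card_penultimate_level[OF assms(1)] by linarith
  moreover obtain v where v: "L m = {v}" using assms(4) level_top card_1_singletonE by metis
  have lt: "?p < m" "Suc (Suc (Suc q)) < m" using assms(1) by simp_all
  \<comment> \<open>The six top levels have at most 10 vertices; the two cases would need at least 1
    + 2 + 8 and 1 + 3 + 6 + 1.\<close>
  note six = six_levels[OF assms(1), unfolded assms(3,4)]
  ultimately show False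
  proof cases
    case 1
    then show False
      using two_pendants_four_levels[OF lt(1) single_top_two[OF assms(1) v 1]] six by linarith
  next
    case 2
    then obtain a b c where "pendant_apart ?p a b c" using single_top_three[OF assms(1) v] by blast
    then show False
      using pendant_apart_three_levels[of "Suc q" a b c] lt(1) six card_level_pos[of q] 2 by simp
  qed
qed

lemma type0_levels:
  assumes "m = Suc (Suc (Suc (Suc (Suc q))))" "\<not> type1 V E" "card V = q + 11"
  shows "3 \<le> card (level m) \<and> 3 \<le> card (level (Suc (Suc (Suc (Suc q)))))"
proof (rule ccontr)
  let ?p = "Suc (Suc (Suc (Suc q)))"
  assume neg: "\<not> (3 \<le> card (level m) \<and> 3 \<le> card (level ?p))"
  have lt: "?p < m" using assms(1) by simp
  note six = six_levels[OF assms(1), unfolded assms(3)]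
  have pos: "1 \<le> card (level q)" "1 \<le> card (level (Suc q))" "1 \<le> card (level (Suc (Suc q)))"
    using card_level_pos lt by simp_all
  have big: "2 \<le> card (level m)" "2 \<le> card (level ?p)" "2 \<le> card (level (Suc (Suc (Suc q))))"
    using type0_card_top[OF assms(1,2)] card_penultimate_level[OF assms(1)] card_third_level[OF assms(1)] .
  have apart: "6 \<le> card (level (Suc (Suc (Suc q)))) + card (level (Suc (Suc q))) + card (level (Suc q))"
    if "\<exists>a b c. pendant_apart ?p a b c"
    using pendant_apart_three_levels[of "Suc q"] that lt by blast
  \<comment> \<open>The lower three of the six levels take at least 3 of the 11 vertices, leaving at
    most 8 for the upper three. In each resulting case the lower bounds add up to at least
    12.\<close>
  have split: "x = 2 \<and> y = 2 \<or> x = 2 \<and> y = 3 \<or> x = 3 \<and> y = 2 \<or>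
      x = 2 \<and> y = 4 \<and> z = 2 \<or> x = 4 \<and> y = 2 \<and> z = 2"
    if "\<not> (3 \<le> x \<and> 3 \<le> y)" "x + y + z \<le> 8" "2 \<le> x" "2 \<le> y" "2 \<le> z" for x y z :: nat
    using that by presburger
  have "card (level m) + card (level ?p) + card (level (Suc (Suc (Suc q)))) \<le> 8"
    using six pos by linarith
  from split[OF neg this big]
  consider "card (level m) = 2" "card (level ?p) = 2" | "card (level m) = 2" "card (level ?p) = 3"
    | "card (level m) = 3" "card (level ?p) = 2"
    | "card (level m) = 2" "card (level ?p) = 4" "card (level (Suc (Suc (Suc q)))) = 2"
    | "card (level m) = 4" "card (level ?p) = 2" "card (level (Suc (Suc (Suc q)))) = 2"
    by blast
  then show False
  proof cases
    case 1
    then show False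
      using two_pendants_four_levels[OF lt type0_two_two[OF assms(1,2) 1]] six by linarith
  next
    case 2
    then show False using apart[OF type0_two_three[OF assms(1,2) 2]] six pos by linarith
  next
    case 3
    then show False using apart[OF type0_three_two[OF assms(1,2) 3]] six pos by linarith
  next
    case 4
    then show False using type0_two_four_below[OF assms(1,2) 4] six pos by linarith
  next
    case 5
    then show False using type0_two_below[OF assms(1,2) 5(2,3)] six pos by linarith
  qed
qed

section \<open>Capture time in terms of corner rank and type\<close>

lemma cop_wins_in_1I: "v \<in> S \<Longrightarrow> \<forall>r\<in>S. E v r \<Longrightarrow> cop_wins_in S E (Suc 0)"
  unfolding cop_wins_in_def by (rule bexI[of _ v]) auto

lemma cop_wins_in_Suc_top: "cop_wins_in V E (Suc m)"
proof -
  obtain v where v: "v \<in> L m" using top_nonempty by blast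
  have "cop_wins_in (L m) E (Suc 0)"
    by (rule cop_wins_in_1I[OF v]) (use v clique_top in \<open>auto simp: is_clique_def\<close>)
  from cop_wins_in_lift[OF _ this] not_clique show ?thesis by simp
qed

text \<open>The dominated layer \<open>L (m - 1)\<close> is won in one move, and each earlier layer
  costs one more. Conversely, a dominating vertex of \<open>L (m - 2)\<close> would already make
  \<open>L (m - 1)\<close> a clique.\<close>

lemma capture_time_type1:
  assumes "m = Suc (Suc p)" "type1 V E"
  shows "capture_time V E = m"
proof -
  obtain v where v: "v \<in> L m" "dominates E v (L (Suc p))" using type1_iff[OF assms(1)] assms(2) by blast
  then have "v \<in> L (Suc p)" using assms(1) layer_step[of "Suc p"] by blast
  then have "cop_wins_in (L (Suc p)) E (Suc 0)"
    by (rule cop_wins_in_1I) (use v(2) in \<open>simp add: dominates_def\<close>)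
  from cop_wins_in_lift[OF _ this] not_clique assms(1) have "cop_wins_in V E (Suc (Suc p))" by simp
  moreover have "\<not> (\<exists>d\<in>L p. dominates E d (L p))"
    using dominated_layer_Suc_clique not_clique[of "Suc p"] assms(1) by blast
  then have "\<not> cop_wins_in V E (Suc p)"
    using not_cop_wins_in[of p] not_clique assms(1) by simp
  ultimately show ?thesis using capture_time_eqI assms(1) by blast
qed

text \<open>Vertices of \<open>level p\<close> never dominate and type 0 excludes the top ones, so
  \<open>L p\<close> has no dominating vertex and the robber survives \<open>m\<close>
  moves.\<close>

lemma capture_time_type0:
  assumes "m = Suc p" "\<not> type1 V E"
  shows "capture_time V E = Suc m"
proof -
  have "\<not> dominates E d (L p)" if "d \<in> L p" for d
    using level_not_dominates[of p d] that assms(1) type1_iff[OF assms(1)] assms(2) by blast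
  then have "\<not> cop_wins_in V E (Suc p)"
    using not_cop_wins_in[of p] not_clique assms(1) by simp
  then show ?thesis using capture_time_eqI[OF cop_wins_in_Suc_top] assms(1) by blast
qed

lemma capture_time_le: "capture_time V E \<le> Suc m"
  unfolding capture_time_def by (rule Least_le) (rule cop_wins_in_Suc_top)

definition rank_cards :: "nat list" where
  "rank_cards = map (\<lambda>i. card (level (m - i))) [0..<Suc m]"

lemma realizes_iff:
  assumes "cop_win V E"
  shows "realizes V E r xs \<longleftrightarrow>
    1 \<le> m \<and> (r = 1 \<and> type1 V E \<or> r = 0 \<and> \<not> type1 V E) \<and> xs = rank_cards"
proof -
  have "rank_set V E (Suc m - i) = level (m - i)" if "i < Suc m" for i
    using that by (simp add: rank_set_def Suc_diff_le)
  then have "xs = rank_cards \<longleftrightarrow> length xs = Suc m \<and>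
      (\<forall>i<length xs. xs ! i = card (rank_set V E (Suc m - i)))"
    by (auto simp: rank_cards_def list_eq_iff_nth_eq simp del: upt_Suc)
  moreover have "finite_corner_rank V E"
    using clique_top unfolding finite_corner_rank_def by blast
  ultimately show ?thesis
    using assms unfolding realizes_def corner_rank_eq by auto
qed

lemma length_rank_cards: "length rank_cards = Suc m"
  by (simp add: rank_cards_def)

lemma nth_rank_cards: "i \<le> m \<Longrightarrow> rank_cards ! i = card (level (m - i))"
  by (simp add: rank_cards_def del: upt_Suc)

lemma sum_rank_cards: "sum_list rank_cards = card V"
proof -
  have "sum_list rank_cards = (\<Sum>i<Suc m. card (level (m - i)))"
    by (simp add: rank_cards_def interv_sum_list_conv_sum_set_nat atLeast0LessThan del: upt_Suc sum.lessThan_Suc)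
  also have "\<dots> = (\<Sum>j<Suc m. card (level j))"
    using sum.nat_diff_reindex[of "\<lambda>j. card (level j)" "Suc m"] by simp
  finally show ?thesis using sum_card_levels by (simp add: lessThan_Suc_atMost)
qed

end

section \<open>Vectors determined by entrywise lower bounds and their sum\<close>

lemma list_eqI_sum:
  fixes xs ys :: "nat list"
  assumes "length ys = length xs" "\<And>i. i < length ys \<Longrightarrow> ys ! i \<le> xs ! i" "sum_list xs \<le> sum_list ys"
  shows "xs = ys"
  using assms
proof (induction ys xs rule: list_induct2)
  case (Cons y ys x xs)
  have x: "y \<le> x" using Cons.prems(1)[of 0] by simp
  have le: "ys ! i \<le> xs ! i" if "i < length ys" for i using Cons.prems(1)[of "Suc i"] that by simp
  have "sum_list ys \<le> sum_list xs" using Cons.hyps le by (intro sum_list_mono2) simp_all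
  then have sums: "x = y" "sum_list xs \<le> sum_list ys" using x Cons.prems(2) by simp_all
  from Cons.IH[OF le sums(2)] sums(1) show ?case by simp
qed simp

text \<open>Raising one entry that is too small by 1 gives a vector that is still a lower bound and
  has the full sum.\<close>

lemma list_update_eqI_sum:
  fixes xs ys :: "nat list"
  assumes "length ys = length xs" "\<And>i. i < length ys \<Longrightarrow> ys ! i \<le> xs ! i"
    "sum_list xs = Suc (sum_list ys)"
  shows "\<exists>i<length ys. xs = ys[i := ys ! i + 1]"
proof -
  have "\<exists>i<length ys. ys ! i \<noteq> xs ! i"
    using assms(1,3) by (metis nth_equalityI n_not_Suc_n)
  then obtain i where i: "i < length ys" "ys ! i < xs ! i"
    using assms(2) by (metis le_neq_implies_less)
  have "xs = ys[i := ys ! i + 1]"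
    by (rule list_eqI_sum) (use assms i in \<open>auto simp: nth_list_update sum_list_update\<close>)
  with i show ?thesis by blast
qed

lemma nth_four_replicate:
  "i < 4 + k \<Longrightarrow> ([a, b, c, d] @ replicate k d) ! i =
    (if i = 0 then a else if i = 1 then b else if i = 2 then c else d)"
  by (auto simp: nth_append nth_Cons split: nat.split)

theorem theorem5p2:
  fixes V :: "'a set" and E :: "'a \<Rightarrow> 'a \<Rightarrow> bool" and n :: nat
  assumes "rgraph V E" and "cop_win V E" and "card V = n" and "n \<ge> 11"
  shows "capture_time V E = n - 5 \<longleftrightarrow>
     (\<exists>xs. standard_extension [1,4,2,1] xs \<and> realizes V E 1 xs) \<or>
     (\<exists>ys i. standard_extension [2,2,2,1] ys \<and> i < length ys \<and>
             realizes V E 1 (ys[i := ys ! i + 1])) \<or>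
     (\<exists>xs. standard_extension [3,3,2,1] xs \<and> realizes V E 0 xs)"
    (is "_ \<longleftrightarrow> ?one \<or> ?two \<or> ?three")
proof -
  interpret reflexive_graph V E by unfold_locales (rule assms(1))
  define m where "m = (LEAST k. is_clique E (layer V E k))"
  have ex: "\<exists>k. is_clique E (layer V E k)"
    using cop_win_finite_corner_rank[OF assms(2)] unfolding finite_corner_rank_def .
  interpret corner_ranked V E m
  proof unfold_locales
    show "is_clique E (layer V E m)" unfolding m_def by (rule LeastI_ex[OF ex])
    show "\<not> is_clique E (layer V E k)" if "k < m" for k
      using that unfolding m_def by (rule not_less_Least)
  qed
  note real = realizes_iff[OF assms(2)]
  show ?thesis
  proof
    assume cap: "capture_time V E = n - 5"
    \<comment> \<open>Here \<open>n - 5\<close> is at least 6, while the capture time is at most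
      \<open>m + 1\<close>.\<close>
    then have "5 \<le> m" using capture_time_le assms(4) by linarith
    define q where "q = m - 5"
    have mq: "m = q + 5" using \<open>5 \<le> m\<close> by (simp add: q_def)
    then have q: "m = Suc (Suc (Suc (Suc (Suc q))))" by simp
    \<comment> \<open>With \<open>q + 2\<close> appended entries the vector has length
      \<open>q + 6 = m + 1\<close>, the corner rank.\<close>
    define ext where "ext = (\<lambda>a b c. [a, b, c, 1::nat] @ replicate (q + 2) 1)"
    have len: "length (ext a b c) = length rank_cards" for a b c
    proof -
      have "length (ext a b c) = Suc m" by (simp add: ext_def mq)
      then show ?thesis by (simp only: length_rank_cards)
    qed
    have ext: "standard_extension [a, b, c, 1] (ext a b c)" for a b c
      unfolding ext_def standard_extension_def by (rule exI[of _ "q + 2"]) simp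
    have sum_ext: "sum_list (ext a b c) = a + b + c + q + 3" for a b c
      unfolding ext_def by (simp add: sum_list_replicate)
    have ge: "ext a b c ! i \<le> rank_cards ! i"
      if "a \<le> card (level m)" "b \<le> card (level (m - 1))" "c \<le> card (level (m - 2))"
        "i < length (ext a b c)" for a b c i
    proof -
      have "i < Suc m" using that(4) by (simp only: len length_rank_cards)
      then have i: "i < 4 + (q + 2)" "i \<le> m" unfolding mq by simp_all
      show ?thesis
        unfolding ext_def nth_four_replicate[OF i(1)] nth_rank_cards[OF i(2)]
        using that(1-3) card_level_pos[of "m - i"] by simp
    qed
    have p: "m - 1 = Suc (Suc (Suc (Suc q)))" using mq by simp
    have second: "2 \<le> card (level (m - 1))" by (rule card_penultimate_level) (simp add: mq)
    have third: "2 \<le> card (level (m - 2))" by (rule card_third_level) (simp add: mq)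
    have m1: "1 \<le> m" using mq by simp
    show "?one \<or> ?two \<or> ?three"
    proof (cases "type1 V E")
      case True
      have "n - 5 = m" using capture_time_type1[OF q True] cap by simp
      \<comment> \<open>This is the sum of \<open>ext 1 4 2\<close>; the sum of
        \<open>ext 2 2 2\<close> falls short of it by exactly one.\<close>
      then have n: "card V = q + 10" using mq assms(3,4) by simp
      show ?thesis
      proof (cases "card (level m) = 1")
        case c1: True
        have "4 \<le> card (level (m - 1))" using type1_levels[OF q True n c1] unfolding p .
        then have "rank_cards = ext 1 4 2"
          by (intro list_eqI_sum len ge) (use c1 third in \<open>simp_all add: sum_ext sum_rank_cards n\<close>)
        then have "realizes V E 1 (ext 1 4 2)" using True real m1 by simp
        then show ?thesis using ext by blast
      next
        case False
        then have "2 \<le> card (level m)" using two_le_card[of m] by simp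
        then have "\<exists>i<length (ext 2 2 2). rank_cards = (ext 2 2 2)[i := ext 2 2 2 ! i + 1]"
          by (intro list_update_eqI_sum len ge)
            (use second third in \<open>simp_all add: sum_ext sum_rank_cards n\<close>)
        then obtain i where i: "i < length (ext 2 2 2)"
          "rank_cards = (ext 2 2 2)[i := ext 2 2 2 ! i + 1]" by blast
        have "realizes V E 1 ((ext 2 2 2)[i := ext 2 2 2 ! i + 1])"
          unfolding real using True m1 i(2) by simp
        then show ?thesis using ext i(1) by blast
      qed
    next
      case False
      have "n - 5 = Suc m" using capture_time_type0[OF q False] cap by simp
      \<comment> \<open>This is the sum of \<open>ext 3 3 2\<close>.\<close>
      then have n: "card V = q + 11" using mq assms(3,4) by simp
      have "3 \<le> card (level m)" "3 \<le> card (level (m - 1))"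
        using type0_levels[OF q False n] unfolding p by blast+
      then have "rank_cards = ext 3 3 2"
        by (intro list_eqI_sum len ge) (use third in \<open>simp_all add: sum_ext sum_rank_cards n\<close>)
      then have "realizes V E 0 (ext 3 3 2)" using False real m1 by simp
      then show ?thesis using ext by blast
    qed
  next
    assume "?one \<or> ?two \<or> ?three"
    then consider
        (one) xs where "standard_extension [1,4,2,1] xs" "realizes V E 1 xs"
      | (two) ys i where "standard_extension [2,2,2,1] ys" "i < length ys"
          "realizes V E 1 (ys[i := ys ! i + 1])"
      | (three) xs where "standard_extension [3,3,2,1] xs" "realizes V E 0 xs"
      by blast
    then show "capture_time V E = n - 5"
    proof cases
      case one
      then have xs: "rank_cards = xs" "type1 V E" using real by simp_all
      obtain k where k: "xs = [1,4,2,1] @ replicate k 1"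
        using one(1) unfolding standard_extension_def by auto
      \<comment> \<open>Length and sum of the vector give \<open>n - 5 = m\<close>, the capture time
        in type 1.\<close>
      have "m = k + 3" "n = k + 8"
        using length_rank_cards sum_rank_cards unfolding xs(1) k assms(3)
        by (simp_all add: sum_list_replicate)
      then show ?thesis using capture_time_type1[of "k + 1"] xs(2) by simp
    next
      case two
      then have xs: "rank_cards = ys[i := ys ! i + 1]" "type1 V E" using real by simp_all
      obtain k where k: "ys = [2,2,2,1] @ replicate k 1"
        using two(1) unfolding standard_extension_def by auto
      then have ys: "length ys = k + 4" "sum_list ys = k + 7" by (simp_all add: sum_list_replicate)
      have "m = k + 3"
        using length_rank_cards ys(1) unfolding xs(1) by simp
      moreover have "n = k + 8"
      proof -
        have "ys ! i \<le> sum_list ys" using two(2) by (intro member_le_sum_list) simp_all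
        then show ?thesis
          using sum_rank_cards ys(2) two(2) unfolding xs(1) assms(3) by (simp add: sum_list_update)
      qed
      ultimately show ?thesis using capture_time_type1[of "k + 1"] xs(2) by simp
    next
      case three
      then have xs: "rank_cards = xs" "\<not> type1 V E" using real by simp_all
      obtain k where k: "xs = [3,3,2,1] @ replicate k 1"
        using three(1) unfolding standard_extension_def by auto
      \<comment> \<open>Here \<open>n - 5 = m + 1\<close>, the capture time in type 0.\<close>
      have "m = k + 3" "n = k + 9"
        using length_rank_cards sum_rank_cards unfolding xs(1) k assms(3)
        by (simp_all add: sum_list_replicate)
      then show ?thesis using capture_time_type0[of "k + 2"] xs(2) by simp
    qed
  qed
qed

end
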